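(* Let $G$ be a word-hyperbolic group with finite symmetric generating set $S$. For every oriented simplicial path $\sigma$ of length at least $2$ in the Cayley graph $C_S(G)$, the counting quasimorphism $\phi_\sigma=c_\sigma-c_{\sigma^{-1}}$ is bicombable.
   Context: Counting quasimorphisms. $\sigma^{-1}$ is the path $\sigma$ with opposite orientation. A copy of $\sigma$ is a translate $a\cdot\sigma$, $a\in G$. For an oriented simplicial path $\alpha$ in $C_S(G)$, $|\alpha|_\sigma$ is the maximal number of disjoint copies of $\sigma$ contained in $\alpha$. For a directed path $\alpha$ from $\mathrm{id}$ to $a$, $c_\sigma(\alpha)=|a|-(\mathrm{length}(\alpha)-|\alpha|_\sigma)$, where $|a|$ is word length with respect to $S$, and $c_\sigma(a)=\sup_\alpha c_\sigma(\alpha)$ over all directed paths $\alpha$ in $C_S(G)$ from $\mathrm{id}$ to $a$. Then $\phi_\sigma(a):=c_\sigma(a)-c_{\sigma^{-1}}(a)$. Combings. $S$ generates $G$ as a semigroup. $S^*$ is the set of finite words in $S$; for $w\in S^*$, $|w|$ is its length and $\overline{w}\in G$ its evaluation. A finite digraph $\Gamma$ with initial vertex $v_1$, whose edges are labeled by letters of $S$ with at most one outgoing edge with any given label at each vertex, parameterizes a prefix-closed language $L\subset S^*$ if $L$ is exactly the set of words read along directed paths starting at $v_1$; a prefix-closed language is regular iff it is parameterized by some such $\Gamma$. A combing of $G$ with respect to $S$ is a prefix-closed regular language $L\subset S^*$ such that evaluation $L\to G$ is a bijection and every $w\in L$ is geodesic. $\phi:G\to\mathbb{Z}$ is weakly combable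 with respect to $S,L$ if there are a digraph $\Gamma$ parameterizing $L$ and a function $d\phi$ from its vertices to $\mathbb{Z}$ with $\phi(\overline{w})=\sum_{i=0}^{|w|}d\phi(\gamma(i))$ for all $w\in L$, where $\gamma$ is the path in $\Gamma$ starting at $v_1$ corresponding to $w$ and $\gamma(i)$ is the vertex reached after $i$ edges ($\gamma(0)=v_1$). It is bicombable if moreover there is $C$ with $|\phi(as)-\phi(a)|\le C$ and $|\phi(sa)-\phi(a)|\le C$ for all $a\in G$, $s\in S$. For word-hyperbolic $G$, bicombability does not depend on the choice of finite symmetric generating set or combing. *)

theory Defs
  imports
    "HOL-Algebra.Generated_Groups"
    "HOL-Library.Disjoint_Sets"
    "HOL-Library.Sublist"
    "Graph_Theory.Arc_Walk"
begin

text \<open>For a symmetric set, generation as a group and by words agree; in particular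
  the empty set generates the trivial group (with the empty word).\<close>

definition sym_generating_set :: "('a, 'b) monoid_scheme \<Rightarrow> 'a set \<Rightarrow> bool" where
  "sym_generating_set G S \<longleftrightarrow>
     finite S \<and> S \<subseteq> carrier G \<and> (\<forall>s\<in>S. inv\<^bsub>G\<^esub> s \<in> S) \<and> generate G S = carrier G"

definition word_eval :: "('a, 'b) monoid_scheme \<Rightarrow> 'a list \<Rightarrow> 'a" where
  "word_eval G w = foldr (\<otimes>\<^bsub>G\<^esub>) w \<one>\<^bsub>G\<^esub>"

definition word_length :: "('a, 'b) monoid_scheme \<Rightarrow> 'a set \<Rightarrow> 'a \<Rightarrow> nat" where
  "word_length G S a = (LEAST n. \<exists>w\<in>lists S. length w = n \<and> word_eval G w = a)"


text \<open>The arc \<open>(g, s)\<close> of the Cayley graph runs from \<open>g\<close> to \<open>gs\<close>. An oriented simplicial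
  path is a directed walk, given by its list of arcs; \<open>G\<close> acts by left translation.\<close>

definition cayley_graph :: "('a, 'b) monoid_scheme \<Rightarrow> 'a set \<Rightarrow> ('a, 'a \<times> 'a) pre_digraph" where
  "cayley_graph G S =
     \<lparr>verts = carrier G, arcs = carrier G \<times> S, tail = fst, head = (\<lambda>(g, s). g \<otimes>\<^bsub>G\<^esub> s)\<rparr>"

definition cayley_path ::
    "('a, 'b) monoid_scheme \<Rightarrow> 'a set \<Rightarrow> 'a \<Rightarrow> ('a \<times> 'a) list \<Rightarrow> 'a \<Rightarrow> bool" where
  "cayley_path G S = pre_digraph.awalk (cayley_graph G S)"

definition path_verts ::
    "('a, 'b) monoid_scheme \<Rightarrow> 'a set \<Rightarrow> 'a \<Rightarrow> ('a \<times> 'a) list \<Rightarrow> 'a set" where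
  "path_verts G S x p = set (pre_digraph.awalk_verts (cayley_graph G S) x p)"

definition cayley_dist :: "('a, 'b) monoid_scheme \<Rightarrow> 'a set \<Rightarrow> 'a \<Rightarrow> 'a \<Rightarrow> nat" where
  "cayley_dist G S x y = word_length G S (inv\<^bsub>G\<^esub> x \<otimes>\<^bsub>G\<^esub> y)"

definition cayley_geodesic ::
    "('a, 'b) monoid_scheme \<Rightarrow> 'a set \<Rightarrow> 'a \<Rightarrow> ('a \<times> 'a) list \<Rightarrow> 'a \<Rightarrow> bool" where
  "cayley_geodesic G S x p y \<longleftrightarrow> cayley_path G S x p y \<and> length p = cayley_dist G S x y"


text \<open>Thin triangles, formulated on the vertices of the Cayley graph. Triangles whose corners or
  test points lie inside edges only change the constant \<open>\<delta>\<close>. Hyperbolicity of a group asks for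
  some finite symmetric generating set \<open>T\<close>.\<close>

definition hyperbolic_cayley_graph :: "('a, 'b) monoid_scheme \<Rightarrow> 'a set \<Rightarrow> bool" where
  "hyperbolic_cayley_graph G S \<longleftrightarrow>
     (\<exists>\<delta>. \<forall>x y z p q r.
        cayley_geodesic G S x p y \<and> cayley_geodesic G S y q z \<and> cayley_geodesic G S x r z \<longrightarrow>
        (\<forall>u\<in>path_verts G S x p. \<exists>v\<in>path_verts G S y q \<union> path_verts G S x r.
           cayley_dist G S u v \<le> \<delta>))"

definition word_hyperbolic :: "('a, 'b) monoid_scheme \<Rightarrow> bool" where
  "word_hyperbolic G \<longleftrightarrow> (\<exists>T. sym_generating_set G T \<and> hyperbolic_cayley_graph G T)"


definition translate_path ::
    "('a, 'b) monoid_scheme \<Rightarrow> 'a \<Rightarrow> ('a \<times> 'a) list \<Rightarrow> ('a \<times> 'a) list" where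
  "translate_path G a = map (\<lambda>(g, s). (a \<otimes>\<^bsub>G\<^esub> g, s))"

definition reverse_path ::
    "('a, 'b) monoid_scheme \<Rightarrow> ('a \<times> 'a) list \<Rightarrow> ('a \<times> 'a) list" where
  "reverse_path G p = rev (map (\<lambda>(g, s). (g \<otimes>\<^bsub>G\<^esub> s, inv\<^bsub>G\<^esub> s)) p)"

text \<open>Positions at which a copy of \<open>\<sigma>\<close> occurs as a subpath of \<open>\<alpha>\<close>.\<close>

definition copy_positions ::
    "('a, 'b) monoid_scheme \<Rightarrow> ('a \<times> 'a) list \<Rightarrow> ('a \<times> 'a) list \<Rightarrow> nat set" where
  "copy_positions G \<sigma> \<alpha> =
     {i. i + length \<sigma> \<le> length \<alpha> \<and>
         (\<exists>a\<in>carrier G. take (length \<sigma>) (drop i \<alpha>) = translate_path G a \<sigma>)}"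

text \<open>Copies are disjoint if they do not overlap as subpaths of \<open>\<alpha>\<close>, i.e. occupy disjoint sets of
  edge positions; consecutive copies may share an endpoint.\<close>

definition copy_count ::
    "('a, 'b) monoid_scheme \<Rightarrow> ('a \<times> 'a) list \<Rightarrow> ('a \<times> 'a) list \<Rightarrow> nat" where
  "copy_count G \<sigma> \<alpha> =
     Max (card ` {P. P \<subseteq> copy_positions G \<sigma> \<alpha> \<and>
                     disjoint_family_on (\<lambda>i. {i..<i + length \<sigma>}) P})"

definition path_weight ::
    "('a, 'b) monoid_scheme \<Rightarrow> 'a set \<Rightarrow> ('a \<times> 'a) list \<Rightarrow> 'a \<Rightarrow> ('a \<times> 'a) list \<Rightarrow> int" where
  "path_weight G S \<sigma> a \<alpha> =
     int (word_length G S a) - (int (length \<alpha>) - int (copy_count G \<sigma> \<alpha>))"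

text \<open>For \<open>length \<sigma> \<ge> 1\<close> one has \<open>copy_count G \<sigma> \<alpha> \<le> length \<alpha>\<close>, so the supremum is taken over a
  set of integers bounded above by \<open>word_length G S a\<close> and is attained.\<close>

definition counting_fun ::
    "('a, 'b) monoid_scheme \<Rightarrow> 'a set \<Rightarrow> ('a \<times> 'a) list \<Rightarrow> 'a \<Rightarrow> int" where
  "counting_fun G S \<sigma> a =
     Sup {path_weight G S \<sigma> a \<alpha> | \<alpha>. cayley_path G S \<one>\<^bsub>G\<^esub> \<alpha> a}"

definition counting_quasimorphism ::
    "('a, 'b) monoid_scheme \<Rightarrow> 'a set \<Rightarrow> ('a \<times> 'a) list \<Rightarrow> 'a \<Rightarrow> int" where
  "counting_quasimorphism G S \<sigma> a =
     counting_fun G S \<sigma> a - counting_fun G S (reverse_path G \<sigma>) a"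


text \<open>Being finite, the digraphs \<open>\<Gamma>\<close> may be taken to have natural numbers as vertices and arcs;
  \<open>lab\<close> is the edge labelling.\<close>

definition parameterizes ::
    "(nat, nat) pre_digraph \<Rightarrow> nat \<Rightarrow> (nat \<Rightarrow> 'a) \<Rightarrow> 'a set \<Rightarrow> 'a list set \<Rightarrow> bool" where
  "parameterizes \<Gamma> v\<^sub>1 lab S L \<longleftrightarrow>
     fin_digraph \<Gamma> \<and> v\<^sub>1 \<in> verts \<Gamma> \<and>
     (\<forall>e\<in>arcs \<Gamma>. lab e \<in> S) \<and>
     (\<forall>e\<in>arcs \<Gamma>. \<forall>f\<in>arcs \<Gamma>. tail \<Gamma> e = tail \<Gamma> f \<and> lab e = lab f \<longrightarrow> e = f) \<and>
     L = {map lab p | p v. pre_digraph.awalk \<Gamma> v\<^sub>1 p v}"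

definition prefix_closed :: "'a list set \<Rightarrow> bool" where
  "prefix_closed L \<longleftrightarrow> (\<forall>w\<in>L. \<forall>u. prefix u w \<longrightarrow> u \<in> L)"

definition combing :: "('a, 'b) monoid_scheme \<Rightarrow> 'a set \<Rightarrow> 'a list set \<Rightarrow> bool" where
  "combing G S L \<longleftrightarrow>
     L \<subseteq> lists S \<and> prefix_closed L \<and> (\<exists>\<Gamma> v\<^sub>1 lab. parameterizes \<Gamma> v\<^sub>1 lab S L) \<and>
     bij_betw (word_eval G) L (carrier G) \<and>
     (\<forall>w\<in>L. length w = word_length G S (word_eval G w))"

definition weakly_combable ::
    "('a, 'b) monoid_scheme \<Rightarrow> 'a set \<Rightarrow> 'a list set \<Rightarrow> ('a \<Rightarrow> int) \<Rightarrow> bool" where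
  "weakly_combable G S L \<phi> \<longleftrightarrow>
     (\<exists>\<Gamma> v\<^sub>1 lab (d\<phi> :: nat \<Rightarrow> int). parameterizes \<Gamma> v\<^sub>1 lab S L \<and>
        (\<forall>w\<in>L. \<forall>p v. pre_digraph.awalk \<Gamma> v\<^sub>1 p v \<and> map lab p = w \<longrightarrow>
           \<phi> (word_eval G w) = (\<Sum>i=0..length w. d\<phi> (pre_digraph.awalk_verts \<Gamma> v\<^sub>1 p ! i))))"

definition bicombable ::
    "('a, 'b) monoid_scheme \<Rightarrow> 'a set \<Rightarrow> 'a list set \<Rightarrow> ('a \<Rightarrow> int) \<Rightarrow> bool" where
  "bicombable G S L \<phi> \<longleftrightarrow>
     weakly_combable G S L \<phi> \<and>
     (\<exists>C. \<forall>a\<in>carrier G. \<forall>s\<in>S.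
        \<bar>\<phi> (a \<otimes>\<^bsub>G\<^esub> s) - \<phi> a\<bar> \<le> C \<and> \<bar>\<phi> (s \<otimes>\<^bsub>G\<^esub> a) - \<phi> a\<bar> \<le> C)"

end

theory Submission
  imports Defs
begin

text \<open>Let \<open>m\<^sub>\<sigma>(a)\<close> be the minimum of \<open>length(\<alpha>) - |\<alpha>|\<^sub>\<sigma>\<close> over paths \<open>\<alpha>\<close> from the identity to \<open>a\<close>. It is the
  norm of \<open>a\<close> for a weighted generating set in which every copy of \<open>\<sigma>\<close> is an extra generator of
  weight \<open>length(\<sigma>) - 1 > 0\<close>. Since \<open>c\<^sub>\<sigma>(a) = |a| - m\<^sub>\<sigma>(a)\<close>, the counting quasimorphism is a difference of two
  such norms, which makes the Lipschitz conditions immediate. Weighted geodesics are uniform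
  quasi-geodesics, so by the Morse lemma a weighted geodesic to \<open>gh\<close> passes near \<open>g\<close> whenever
  \<open>|gh| = |g| + |h|\<close>. Hence, as for Cannon's cone types, the increments of the norm along a
  continuation of a combing word \<open>w\<close> are determined by the finitely many possible shapes of the
  norm on a ball around \<open>w\<close>, and a Myhill--Nerode construction turns this into a weighted digraph.
  The same argument for the word norm shows that the shortlex geodesics form a combing.\<close>

subsection \<open>Quasi-geodesics in hyperbolic integer-valued metrics\<close>

text \<open>Hyperbolicity is given for some generating set \<open>T\<close>, while the combing and
  the norms live over \<open>S\<close>, and a geodesic over \<open>S\<close> is only a
  quasi-geodesic over \<open>T\<close>. Thinness itself is therefore never carried over to
  \<open>S\<close>: the Morse lemma is proved over \<open>T\<close> for bilipschitz sequences, and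
  only its conclusion, fellow travelling, is moved to \<open>S\<close>. Minimality makes the
  prefixes of a minimal word take distinct values, so \<open>bilip\<close> can do without an
  additive constant.

  The digraph has to be finite although a state must predict the norm on infinitely many
  continuations. This works because only differences to the norm at \<open>w\<close> are recorded,
  and on a ball of fixed radius these are bounded by the Lipschitz property. In the difference of
  the two counting functions the terms |a| cancel; a state then consists of the profiles of two
  norms and the position in a digraph of the given combing.\<close>

definition bilip :: "('a \<Rightarrow> 'a \<Rightarrow> nat) \<Rightarrow> nat \<Rightarrow> nat \<Rightarrow> (nat \<Rightarrow> 'a) \<Rightarrow> bool" where
  "bilip d \<kappa> N f \<longleftrightarrow>
     (\<forall>i j. i \<le> j \<longrightarrow> j \<le> N \<longrightarrow> j - i \<le> \<kappa> * d (f i) (f j) \<and> d (f i) (f j) \<le> \<kappa> * (j - i))"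

text \<open>The Morse argument bounds a distance by a multiple of its own logarithm; this inequality
  turns that into an absolute bound. The threshold works because \<open>2 ^ k\<close> exceeds half
  of the square of \<open>k\<close>.\<close>

lemma power2_dominates_linear:
  fixes c e :: nat
  obtains k0 where "\<And>k. k0 \<le> k \<Longrightarrow> c * k + e < 2 ^ k"
proof
  fix k assume k: "2 * c + e + 5 \<le> k"
  then obtain m where m: "k = m + (2 * c + e + 5)" by (metis add.commute le_Suc_ex)
  have sq: "n * n < 2 * 2 ^ n" for n :: nat
  proof (induction n)
    case (Suc n)
    consider "n = 0" | "n = 1" | "n = 2" | "n \<ge> 3" by linarith
    then show ?case
    proof cases
      case 4
      then have "3 * n \<le> n * n" by simp
      with 4 have "2 * n + 1 \<le> n * n" by linarith
      with Suc have "Suc n * Suc n < 2 * 2 ^ n + n * n" by simp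
      with Suc show ?thesis by simp
    qed auto
  qed simp
  have "(2 * c + e + 5) * k \<le> k * k" using k by simp
  moreover have "2 * (c * k + e) \<le> (2 * c + e + 5) * k"
  proof -
    have "e * 2 \<le> e * k" by (rule mult_le_mono2) (use k in simp)
    then show ?thesis unfolding add_mult_distrib add_mult_distrib2 by linarith
  qed
  ultimately have "2 * (c * k + e) < 2 * 2 ^ k" using sq[of k] by linarith
  then show "c * k + e < 2 ^ k" by simp
qed

text \<open>Thinness is imposed on the intervals \<open>{u. d x u + d u y = d x y}\<close> instead of on chosen
  geodesics. Nothing is lost: for \<open>z\<close> on a second geodesic from \<open>x\<close> to \<open>y\<close>, at the same distance
  from \<open>x\<close> as \<open>u\<close>, the condition gives \<open>d u z \<le> 2 * \<delta>\<close>, so bigons are thin as well.\<close>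

locale hyperbolic_nat_metric =
  fixes X :: "'a set" and d :: "'a \<Rightarrow> 'a \<Rightarrow> nat" and \<delta> :: nat
  assumes zero [simp]: "x \<in> X \<Longrightarrow> d x x = 0"
    and sym: "x \<in> X \<Longrightarrow> y \<in> X \<Longrightarrow> d x y = d y x"
    and tri: "x \<in> X \<Longrightarrow> y \<in> X \<Longrightarrow> z \<in> X \<Longrightarrow> d x z \<le> d x y + d y z"
    and between: "x \<in> X \<Longrightarrow> y \<in> X \<Longrightarrow> k \<le> d x y \<Longrightarrow> \<exists>z\<in>X. d x z = k \<and> d z y = d x y - k"
    and thin: "x \<in> X \<Longrightarrow> y \<in> X \<Longrightarrow> z \<in> X \<Longrightarrow> u \<in> X \<Longrightarrow> d x u + d u y = d x y \<Longrightarrow>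
      \<exists>v\<in>X. (d x v + d v z = d x z \<or> d y v + d v z = d y z) \<and> d u v \<le> \<delta>"
begin

section \<open>Intervals and the Morse lemma for bilipschitz sequences\<close>

definition seg :: "'a \<Rightarrow> 'a \<Rightarrow> 'a set" where
  "seg x y = {u \<in> X. d x u + d u y = d x y}"

lemma thinI:
  assumes "x \<in> X" "y \<in> X" "z \<in> X" "u \<in> seg x y"
  obtains v where "v \<in> seg x z \<union> seg z y" "d u v \<le> \<delta>"
proof -
  from assms obtain v where v: "v \<in> X" "d x v + d v z = d x z \<or> d y v + d v z = d y z" "d u v \<le> \<delta>"
    using thin[of x y z u] unfolding seg_def by auto
  then have "v \<in> seg x z \<union> seg z y"
    using assms sym unfolding seg_def by (auto simp: add.commute)
  with v that show thesis by blast
qed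

lemma seg_sym: "x \<in> X \<Longrightarrow> y \<in> X \<Longrightarrow> seg x y = seg y x"
  unfolding seg_def using sym by (auto simp: add.commute)

lemma seg_in_X: "u \<in> seg x y \<Longrightarrow> u \<in> X" by (simp add: seg_def)

text \<open>Bisection of the index range: a thin triangle over the middle index moves
  \<open>u\<close> by at most \<delta> to the interval of one half, and after \<open>k\<close>
  bisections at most one step of length \<kappa> is left. The distance thus grows only with the
  logarithm of the length.\<close>

lemma interval_near_path:
  assumes "\<And>i. a \<le> i \<Longrightarrow> i \<le> b \<Longrightarrow> f i \<in> X"
    and "\<And>i. a \<le> i \<Longrightarrow> i < b \<Longrightarrow> d (f i) (f (Suc i)) \<le> \<kappa>"
    and "a \<le> b" and "b - a \<le> 2 ^ k" and "u \<in> seg (f a) (f b)"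
  shows "\<exists>i. a \<le> i \<and> i \<le> b \<and> d u (f i) \<le> \<delta> * k + \<kappa>"
  using assms
proof (induction k arbitrary: a b u)
  case 0
  show ?case
  proof (cases "a = b")
    case True
    with 0 have "d u (f a) = 0" by (auto simp: seg_def)
    with True show ?thesis by auto
  next
    case False
    with 0 have b: "b = Suc a" by auto
    have "d u (f b) \<le> d (f a) (f b)" using 0 by (auto simp: seg_def)
    also have "\<dots> \<le> \<kappa>" using 0 b by auto
    finally show ?thesis using b by (intro exI[of _ b]) auto
  qed
next
  case (Suc k)
  define h where "h = a + (b - a) div 2"
  have h: "a \<le> h" "h \<le> b" "h - a \<le> 2 ^ k" "b - h \<le> 2 ^ k"
    using Suc.prems(3,4) unfolding h_def by auto
  have X: "f a \<in> X" "f b \<in> X" "f h \<in> X" using Suc.prems h by auto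
  obtain v where v: "v \<in> seg (f a) (f h) \<union> seg (f h) (f b)" "d u v \<le> \<delta>"
    using thinI[OF X Suc.prems(5)] by blast
  have "\<exists>i. a \<le> i \<and> i \<le> b \<and> d v (f i) \<le> \<delta> * k + \<kappa>"
    using v(1)
  proof
    assume "v \<in> seg (f a) (f h)"
    then have "\<exists>i. a \<le> i \<and> i \<le> h \<and> d v (f i) \<le> \<delta> * k + \<kappa>"
      using Suc.IH[of a h v] Suc.prems h by auto
    then show ?thesis using h by (meson order_trans)
  next
    assume "v \<in> seg (f h) (f b)"
    then have "\<exists>i. h \<le> i \<and> i \<le> b \<and> d v (f i) \<le> \<delta> * k + \<kappa>"
      using Suc.IH[of h b v] Suc.prems h by auto
    then show ?thesis using h by (meson order_trans)
  qed
  then obtain i where i: "a \<le> i" "i \<le> b" "d v (f i) \<le> \<delta> * k + \<kappa>" by blast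
  have "d u (f i) \<le> d u v + d v (f i)"
    using tri Suc.prems i v seg_in_X by (metis UnE)
  with i v show ?case by (intro exI[of _ i]) auto
qed

text \<open>The lower bilipschitz bound limits the number of steps between \<open>f i\<close> and
  \<open>f j\<close> by a multiple of their distance, so the logarithmic estimate can be expressed
  through that distance. Indices in the wrong order are exchanged by symmetry.\<close>

lemma interval_near_bilip_segment:
  assumes "\<And>i. i \<le> N \<Longrightarrow> f i \<in> X" "bilip d \<kappa> N f" "i \<le> N" "j \<le> N"
    and "\<kappa> * d (f i) (f j) \<le> 2 ^ k" and "u \<in> seg (f i) (f j)"
  shows "\<exists>l\<le>N. d u (f l) \<le> \<delta> * k + \<kappa>"
proof -
  have main: "\<exists>l\<le>N. d u (f l) \<le> \<delta> * k + \<kappa>"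
    if ij: "i \<le> j" "j \<le> N" "\<kappa> * d (f i) (f j) \<le> 2 ^ k" "u \<in> seg (f i) (f j)" for i j
  proof -
    have "j - i \<le> 2 ^ k" using assms(2) ij unfolding bilip_def by (meson order_trans)
    moreover have "d (f l) (f (Suc l)) \<le> \<kappa>" if "l < j" for l
    proof -
      have "d (f l) (f (Suc l)) \<le> \<kappa> * (Suc l - l)"
        using assms(2) that ij unfolding bilip_def by (meson Suc_leI le_SucI le_refl order_trans)
      then show ?thesis by simp
    qed
    ultimately obtain l where "i \<le> l" "l \<le> j" "d u (f l) \<le> \<delta> * k + \<kappa>"
      using interval_near_path[of i j f \<kappa> k u] assms(1) ij by auto
    with ij show ?thesis by (meson order_trans)
  qed
  have "f i \<in> X" "f j \<in> X" using assms by auto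
  then show ?thesis
    using main[of i j] main[of j i] assms sym[of "f i" "f j"] seg_sym[of "f i" "f j"]
    by (cases "i \<le> j") auto
qed

text \<open>One direction of the Morse lemma, with \<open>D\<close> uniform in the sequence and its
  length. The uniform bound results from playing a linear estimate of a detour against the
  logarithmic one.\<close>

lemma interval_near_bilip:
  obtains D where "\<And>N f u. (\<And>i. i \<le> N \<Longrightarrow> f i \<in> X) \<Longrightarrow> bilip d \<kappa> N f \<Longrightarrow> u \<in> seg (f 0) (f N)
    \<Longrightarrow> \<exists>i\<le>N. d u (f i) \<le> D"
proof -
  obtain k0 where k0: "\<And>k. k0 \<le> k \<Longrightarrow> (12 * \<kappa> * \<delta>) * k + 12 * \<kappa> * (2 * \<delta> + \<kappa>) < 2 ^ k"
    using power2_dominates_linear by metis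
  have "\<exists>i\<le>N. d u (f i) \<le> \<delta> * k0 + 2 * \<delta> + \<kappa>"
    if fX: "\<And>i. i \<le> N \<Longrightarrow> f i \<in> X" and bl: "bilip d \<kappa> N f" and u: "u \<in> seg (f 0) (f N)" for N f u
  proof -
    define p q where "p = f 0" and "q = f N"
    have pq: "p \<in> X" "q \<in> X" using fX by (auto simp: p_def q_def)
    define r where "r v = Min ((\<lambda>i. d v (f i)) ` {..N})" for v
    have r_ex: "\<exists>i\<le>N. d v (f i) = r v" for v
    proof -
      have "r v \<in> (\<lambda>i. d v (f i)) ` {..N}" unfolding r_def by (rule Min_in) auto
      then show ?thesis by auto
    qed
    have r_le: "r v \<le> d v (f i)" if "i \<le> N" for v i
      unfolding r_def using that by (intro Min_le) auto
    have bound: "\<forall>v. v \<in> seg p q \<longrightarrow> r v \<le> d p q"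
    proof (intro allI impI)
      fix v assume "v \<in> seg p q"
      then have "d v (f N) \<le> d p q" unfolding seg_def q_def by auto
      then show "r v \<le> d p q" using r_le[of N v] by simp
    qed
    obtain m where m: "m \<in> seg p q" and max: "\<And>v. v \<in> seg p q \<Longrightarrow> r v \<le> r m"
      using ex_has_greatest_nat[of "\<lambda>v. v \<in> seg p q" u r "Suc (d p q)"] u bound
      unfolding p_def q_def by (metis le_imp_less_Suc)
    define D where "D = r m"
    have mX: "m \<in> X" and pmq: "d p m + d m q = d p q" using m by (auto simp: seg_def)
    \<comment> \<open>The cut points lie \<open>2 * D\<close> away from \<open>m\<close>, or at
      distance 0 from an endpoint that is nearer; distance 0 need not mean equality in this locale.
      With \<open>2 * D\<close>, every point within \<open>D\<close> of a cut point is still at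
      least \<open>D\<close> away from \<open>m\<close>.\<close>
    obtain y where y: "y \<in> X" "d p y = d p m - min (2 * D) (d p m)" "d y m = min (2 * D) (d p m)"
      using between[OF pq(1) mX, of "d p m - min (2 * D) (d p m)"] by auto
    obtain z where z: "z \<in> X" "d m z = min (2 * D) (d m q)" "d z q = d m q - min (2 * D) (d m q)"
      using between[OF mX pq(2), of "min (2 * D) (d m q)"] by auto
    have mins: "min (2 * D) (d p m) \<le> d p m" "min (2 * D) (d m q) \<le> d m q" by auto
    have yI: "y \<in> seg p q" "z \<in> seg p q" and mI: "m \<in> seg y z"
      using tri[OF pq(1) y(1) pq(2)] tri[OF y(1) mX pq(2)] tri[OF pq(1) mX z(1)] tri[OF pq(1) z(1) pq(2)]
        tri[OF pq(1) y(1) z(1)] tri[OF y(1) mX z(1)] y z pmq pq mX mins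
      unfolding seg_def mem_Collect_eq by linarith+
    \<comment> \<open>\<open>m\<close> is a point of the interval farthest from the path, \<open>D\<close> its distance. The detour
      from \<open>y\<close> over \<open>f i\<close> and \<open>f j\<close> to \<open>z\<close> stays \<open>D\<close> away from \<open>m\<close>, but its length is linear in \<open>D\<close>,
      so the logarithmic bound of \<open>interval_near_path\<close> bounds \<open>D\<close>.\<close>
    have near_y: "\<exists>i\<le>N. d y (f i) \<le> D \<and> (\<forall>v\<in>seg y (f i). D \<le> d m v)"
    proof (cases "2 * D \<le> d p m")
      case True
      obtain i where i: "i \<le> N" "d y (f i) \<le> D"
        using r_ex[of y] max[OF yI(1)] unfolding D_def by auto
      moreover have "D \<le> d m v" if "v \<in> seg y (f i)" for v
      proof -
        have "v \<in> X" "d y v \<le> D" using that i(2) unfolding seg_def by auto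
        then show ?thesis using tri[of y v m] y True sym[of v m] mX by auto
      qed
      ultimately show ?thesis by blast
    next
      case False
      then have "d p y = 0" using y by auto
      moreover have "D \<le> d m v" if "v \<in> seg y p" for v
      proof -
        have v: "v \<in> X" "d v p = 0"
          using that \<open>d p y = 0\<close> sym[of p y] y(1) pq(1) unfolding seg_def by auto
        then show ?thesis using tri[of m v p] r_le[of 0 m] mX pq unfolding D_def p_def by auto
      qed
      ultimately show ?thesis using sym[OF pq(1) y(1)]
        by (intro exI[of _ 0]) (auto simp: p_def)
    qed
    have near_z: "\<exists>j\<le>N. d z (f j) \<le> D \<and> (\<forall>v\<in>seg (f j) z. D \<le> d m v)"
    proof (cases "2 * D \<le> d m q")
      case True
      obtain i where i: "i \<le> N" "d z (f i) \<le> D"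
        using r_ex[of z] max[OF yI(2)] unfolding D_def by auto
      moreover have "D \<le> d m v" if "v \<in> seg (f i) z" for v
      proof -
        have "v \<in> X" "d v z \<le> D" using that i fX[OF i(1)] sym[of z "f i"] z(1) unfolding seg_def by auto
        then show ?thesis using tri[of m v z] z True mX by auto
      qed
      ultimately show ?thesis by blast
    next
      case False
      then have "d z q = 0" using z by auto
      moreover have "D \<le> d m v" if "v \<in> seg q z" for v
      proof -
        have v: "v \<in> X" "d v q = 0"
          using that \<open>d z q = 0\<close> sym[of q z] sym[of q v] z(1) pq unfolding seg_def by auto
        then show ?thesis using tri[of m v q] r_le[of N m] mX pq unfolding D_def q_def by auto
      qed
      ultimately show ?thesis
        by (intro exI[of _ N]) (auto simp: q_def)
    qed
    obtain i where i: "i \<le> N" "d y (f i) \<le> D" "\<And>v. v\<in>seg y (f i) \<Longrightarrow> D \<le> d m v" using near_y by blast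
    obtain j where j: "j \<le> N" "d z (f j) \<le> D" "\<And>v. v\<in>seg (f j) z \<Longrightarrow> D \<le> d m v" using near_z by blast
    have fij: "f i \<in> X" "f j \<in> X" using fX i j by auto
    \<comment> \<open>The summands are \<open>D + 2 * D + 2 * D + D\<close>, along
      \<open>f i\<close>, \<open>y\<close>, \<open>m\<close>, \<open>z\<close>,
      \<open>f j\<close>.\<close>
    have "d (f i) (f j) \<le> 6 * D"
      using tri[of "f i" y "f j"] tri[of y m "f j"] tri[of m z "f j"] sym[of y "f i"] fij y z mX i j by auto
    then have lij: "\<kappa> * d (f i) (f j) \<le> 6 * \<kappa> * D" by simp
    \<comment> \<open>The quadrilateral \<open>y\<close>, \<open>f i\<close>, \<open>f j\<close>,
      \<open>z\<close> is cut into two triangles, so \<open>m\<close> is within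
      \<open>2 * \<delta>\<close> of one of the other three sides. The sides at \<open>y\<close> and
      \<open>z\<close> stay \<open>D\<close> away from \<open>m\<close>; what remains is
      \<open>D \<le> 2 * \<delta>\<close> or the side from \<open>f i\<close> to \<open>f j\<close>,
      where the logarithmic bound applies.\<close>
    have key: "D \<le> \<delta> * k + 2 * \<delta> + \<kappa>" if k: "6 * \<kappa> * D \<le> 2 ^ k" for k
    proof -
      obtain v where v: "v \<in> seg y (f i) \<union> seg (f i) z" "d m v \<le> \<delta>"
        using thinI[OF y(1) z(1) fij(1) mI] by blast
      show ?thesis
      proof (cases "v \<in> seg y (f i)")
        case True
        then show ?thesis using i(3)[OF True] v by auto
      next
        case False
        then have vI: "v \<in> seg (f i) z" using v by blast
        obtain w where w: "w \<in> seg (f i) (f j) \<union> seg (f j) z" "d v w \<le> \<delta>"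
          using thinI[OF fij(1) z(1) fij(2) vI] by blast
        have wX: "w \<in> X" "v \<in> X" using w vI seg_in_X by auto
        have mw: "d m w \<le> 2 * \<delta>" using tri[OF mX wX(2) wX(1)] w v by auto
        show ?thesis
        proof (cases "w \<in> seg (f j) z")
          case True
          then show ?thesis using j(3)[OF True] mw by auto
        next
          case False
          then have "w \<in> seg (f i) (f j)" using w by blast
          then obtain l where l: "l \<le> N" "d w (f l) \<le> \<delta> * k + \<kappa>"
            using interval_near_bilip_segment[OF fX bl i(1) j(1), of k w] lij k by auto
          then show ?thesis using tri[OF mX wX(1) fX[OF l(1)]] mw r_le[OF l(1), of m]
            unfolding D_def by auto
        qed
      qed
    qed
    \<comment> \<open>The binary logarithm of \<open>6 * \<kappa> * D\<close>, rounded up. Above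
      \<open>k0\<close>, minimality gives \<open>2 ^ k < 12 * \<kappa> * D\<close> while
      \<open>key\<close> bounds \<open>D\<close> linearly in \<open>k\<close>; \<open>k0\<close> was
      chosen to exclude exactly this.\<close>
    define k where "k = (LEAST k. 6 * \<kappa> * D \<le> 2 ^ k)"
    have kk: "6 * \<kappa> * D \<le> 2 ^ k" unfolding k_def
      by (rule LeastI[of _ "6 * \<kappa> * D"]) (simp add: less_imp_le)
    have "k \<le> k0"
    proof (rule ccontr)
      assume "\<not> k \<le> k0"
      then obtain k' where k': "k = Suc k'" "k0 \<le> k'" by (cases k) auto
      then have "\<not> 6 * \<kappa> * D \<le> 2 ^ k'" unfolding k_def by (intro not_less_Least) auto
      then have "2 ^ k' < 6 * \<kappa> * D" by (simp only: not_le)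
      then have "2 ^ k < 12 * \<kappa> * D" unfolding k' power_Suc by linarith
      also have "\<dots> \<le> 12 * \<kappa> * (\<delta> * k + 2 * \<delta> + \<kappa>)" using key[OF kk] by simp
      also have "\<dots> = (12 * \<kappa> * \<delta>) * k + 12 * \<kappa> * (2 * \<delta> + \<kappa>)" by (simp add: algebra_simps)
      also have "\<dots> < 2 ^ k" by (rule k0) (use k' in simp)
      finally have "(2::nat) ^ k < 2 ^ k" .
      then show False by simp
    qed
    then have "\<delta> * k \<le> \<delta> * k0" by simp
    then have "D \<le> \<delta> * k0 + 2 * \<delta> + \<kappa>" using key[OF kk] by linarith
    moreover have "r u \<le> D" using max u unfolding D_def p_def q_def by blast
    moreover obtain l where "l \<le> N" "d u (f l) = r u" using r_ex by blast
    ultimately show ?thesis by (intro exI[of _ l]) auto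
  qed
  then show thesis using that by blast
qed

lemma bilip_near_interval:
  obtains D where "\<And>N f i. (\<And>i. i \<le> N \<Longrightarrow> f i \<in> X) \<Longrightarrow> bilip d \<kappa> N f \<Longrightarrow> i \<le> N
    \<Longrightarrow> \<exists>u\<in>seg (f 0) (f N). d (f i) u \<le> D"
proof -
  obtain D where D: "\<And>N f u. (\<And>i. i \<le> N \<Longrightarrow> f i \<in> X) \<Longrightarrow> bilip d \<kappa> N f \<Longrightarrow> u \<in> seg (f 0) (f N)
    \<Longrightarrow> \<exists>i\<le>N. d u (f i) \<le> D" using interval_near_bilip by metis
  have "\<exists>u\<in>seg (f 0) (f N). d (f i) u \<le> \<kappa> * (\<kappa> * (2 * D + 1)) + D"
    if fX: "\<And>i. i \<le> N \<Longrightarrow> f i \<in> X" and bl: "bilip d \<kappa> N f" and i: "i \<le> N" for N f i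
  proof -
    define p q where "p = f 0" and "q = f N"
    have pq: "p \<in> X" "q \<in> X" using fX by (auto simp: p_def q_def)
    \<comment> \<open>The last interval point close to some \<open>f j\<close> with \<open>j \<le> i\<close> is also close to some \<open>f j'\<close> with
      \<open>i \<le> j'\<close>; then \<open>j' - j\<close>, and with it the distance to \<open>f i\<close>, is bounded.\<close>
    define A where "A v \<longleftrightarrow> v \<in> seg p q \<and> (\<exists>j\<le>i. d v (f j) \<le> D)" for v
    have Ap: "A p" unfolding A_def using pq by (auto simp: seg_def p_def intro!: exI[of _ 0])
    have bd: "\<forall>v. A v \<longrightarrow> d p v < Suc (d p q)" unfolding A_def seg_def by auto
    obtain g where g: "A g" and max: "\<And>v. A v \<Longrightarrow> d p v \<le> d p g"
      using ex_has_greatest_nat[of A p "d p" "Suc (d p q)"] Ap bd by blast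
    obtain j where gI: "g \<in> seg p q" and j: "j \<le> i" "d g (f j) \<le> D" using g unfolding A_def by blast
    have gX: "g \<in> X" using gI seg_in_X by blast
    have "\<exists>j'. i \<le> j' \<and> j' \<le> N \<and> d g (f j') \<le> D + 1"
    proof (cases "d g q = 0")
      case True
      then show ?thesis using i by (intro exI[of _ N]) (auto simp: q_def)
    next
      case False
      \<comment> \<open>One unit step from \<open>g\<close> towards \<open>q\<close> leaves
        \<open>A\<close> by maximality of \<open>g\<close>, so the index near \<open>g'\<close> lies
        beyond \<open>i\<close>. The step itself accounts for the \<open>+ 1\<close> in the
        bound.\<close>
      obtain g' where g': "g' \<in> X" "d g g' = 1" "d g' q = d g q - 1"
        using between[OF gX pq(2), of 1] False by auto
      have g'seg: "g' \<in> seg p q" and pg': "d p g' = d p g + 1"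
        using tri[OF pq(1) g'(1) pq(2)] tri[OF pq(1) gX g'(1)] g' False gI unfolding seg_def by auto
      obtain j' where j': "j' \<le> N" "d g' (f j') \<le> D"
        using D[OF fX bl] g'seg unfolding p_def q_def by blast
      have "\<not> A g'" using max[of g'] pg' by auto
      then have "i \<le> j'" using j' g'seg unfolding A_def by (meson nat_le_linear)
      moreover have "d g (f j') \<le> D + 1" using tri[OF gX g'(1) fX[OF j'(1)]] g' j' by auto
      ultimately show ?thesis using j' by blast
    qed
    then obtain j' where j': "i \<le> j'" "j' \<le> N" "d g (f j') \<le> D + 1" by blast
    have fj: "f j \<in> X" "f j' \<in> X" "f i \<in> X" using fX j j' i by auto
    have "d (f j) (f j') \<le> 2 * D + 1" using tri[of "f j" g "f j'"] sym[of g "f j"] fj gX j j' by auto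
    then have "\<kappa> * d (f j) (f j') \<le> \<kappa> * (2 * D + 1)" by (rule mult_le_mono2)
    moreover have "j' - j \<le> \<kappa> * d (f j) (f j')" using bl j j' unfolding bilip_def by auto
    ultimately have "i - j \<le> \<kappa> * (2 * D + 1)" using j' by linarith
    then have "\<kappa> * (i - j) \<le> \<kappa> * (\<kappa> * (2 * D + 1))" by (rule mult_le_mono2)
    moreover have "d (f j) (f i) \<le> \<kappa> * (i - j)" using bl j i unfolding bilip_def by auto
    ultimately have "d (f i) g \<le> \<kappa> * (\<kappa> * (2 * D + 1)) + D"
      using tri[of "f i" "f j" g] sym[of "f i" "f j"] sym[of "f j" g] fj gX j by linarith
    then show ?thesis using gI unfolding p_def q_def by blast
  qed
  then show thesis using that by blast
qed

text \<open>In the triangle on the common start and the two ends, the third side has length at most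
  \<open>c\<close>. A point of the first interval is therefore near the second interval or near the
  end \<open>f' N'\<close>; the two directions of the Morse lemma pass from the sequences to the
  intervals and back.\<close>

lemma bilip_fellow_travel:
  obtains M where "\<And>N f N' f' i. (\<And>i. i \<le> N \<Longrightarrow> f i \<in> X) \<Longrightarrow> bilip d \<kappa> N f \<Longrightarrow>
     (\<And>i. i \<le> N' \<Longrightarrow> f' i \<in> X) \<Longrightarrow> bilip d \<kappa> N' f' \<Longrightarrow>
     f 0 = f' 0 \<Longrightarrow> d (f N) (f' N') \<le> c \<Longrightarrow> i \<le> N \<Longrightarrow> \<exists>j\<le>N'. d (f i) (f' j) \<le> M"
proof -
  obtain D where D: "\<And>N f u. (\<And>i. i \<le> N \<Longrightarrow> f i \<in> X) \<Longrightarrow> bilip d \<kappa> N f \<Longrightarrow> u \<in> seg (f 0) (f N)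
    \<Longrightarrow> \<exists>i\<le>N. d u (f i) \<le> D" using interval_near_bilip by metis
  obtain D' where D': "\<And>N f i. (\<And>i. i \<le> N \<Longrightarrow> f i \<in> X) \<Longrightarrow> bilip d \<kappa> N f \<Longrightarrow> i \<le> N
    \<Longrightarrow> \<exists>u\<in>seg (f 0) (f N). d (f i) u \<le> D'" using bilip_near_interval by metis
  have "\<exists>j\<le>N'. d (f i) (f' j) \<le> D' + \<delta> + (D + c)"
    if fX: "\<And>i. i \<le> N \<Longrightarrow> f i \<in> X" and bl: "bilip d \<kappa> N f"
      and fX': "\<And>i. i \<le> N' \<Longrightarrow> f' i \<in> X" and bl': "bilip d \<kappa> N' f'"
      and f0: "f 0 = f' 0" and e: "d (f N) (f' N') \<le> c" and i: "i \<le> N" for N f N' f' i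
  proof -
    have X: "f 0 \<in> X" "f N \<in> X" "f' N' \<in> X" "f i \<in> X" using fX fX' i by auto
    obtain u where u: "u \<in> seg (f 0) (f N)" "d (f i) u \<le> D'" using D'[OF fX bl i] by blast
    obtain v where v: "v \<in> seg (f 0) (f' N') \<union> seg (f' N') (f N)" "d u v \<le> \<delta>"
      using thinI[OF X(1,2,3) u(1)] by blast
    have uv: "u \<in> X" "v \<in> X" using u v seg_in_X by auto
    have "\<exists>j\<le>N'. d v (f' j) \<le> D + c"
    proof (cases "v \<in> seg (f 0) (f' N')")
      case True
      then show ?thesis using D[OF fX' bl', of v] f0 by (metis trans_le_add1)
    next
      case False
      then have "d (f' N') v \<le> c" using v e sym[of "f N" "f' N'"] X unfolding seg_def by auto
      then show ?thesis using sym X uv by (intro exI[of _ N']) auto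
    qed
    then obtain j where j: "j \<le> N'" "d v (f' j) \<le> D + c" by blast
    have "d (f i) (f' j) \<le> D' + \<delta> + (D + c)"
      using tri[of "f i" u "f' j"] tri[of u v "f' j"] X uv fX'[OF j(1)] u v j by auto
    with j show ?thesis by blast
  qed
  then show thesis using that by blast
qed

end

subsection \<open>Word metrics\<close>

context group
begin

lemma word_eval_Nil [simp]: "word_eval G [] = \<one>"
  by (simp add: word_eval_def)

lemma word_eval_Cons [simp]: "word_eval G (s # w) = s \<otimes> word_eval G w"
  by (simp add: word_eval_def)

lemma word_eval_closed [simp, intro]: "set w \<subseteq> carrier G \<Longrightarrow> word_eval G w \<in> carrier G"
  by (induction w) auto

lemma word_eval_append:
  "set u \<subseteq> carrier G \<Longrightarrow> set v \<subseteq> carrier G \<Longrightarrow>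
    word_eval G (u @ v) = word_eval G u \<otimes> word_eval G v"
  by (induction u) (auto simp: m_assoc)

primrec path_of :: "'a \<Rightarrow> 'a list \<Rightarrow> ('a \<times> 'a) list" where
  "path_of x [] = []"
| "path_of x (s # w) = (x, s) # path_of (x \<otimes> s) w"

lemma map_snd_path_of [simp]: "map snd (path_of x w) = w"
  by (induction w arbitrary: x) auto

lemma length_path_of [simp]: "length (path_of x w) = length w"
  by (induction w arbitrary: x) auto

lemma path_of_append:
  "x \<in> carrier G \<Longrightarrow> set u \<subseteq> carrier G \<Longrightarrow>
    path_of x (u @ v) = path_of x u @ path_of (x \<otimes> word_eval G u) v"
  by (induction u arbitrary: x) (auto simp: m_assoc)

lemma translate_path_of:
  "a \<in> carrier G \<Longrightarrow> x \<in> carrier G \<Longrightarrow> set w \<subseteq> carrier G \<Longrightarrow>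
    translate_path G a (path_of x w) = path_of (a \<otimes> x) w"
  by (induction w arbitrary: x) (auto simp: translate_path_def m_assoc)

lemma cayley_path_path_of:
  "x \<in> carrier G \<Longrightarrow> set w \<subseteq> S \<Longrightarrow> S \<subseteq> carrier G \<Longrightarrow>
    cayley_path G S x (path_of x w) (x \<otimes> word_eval G w)"
proof (induction w arbitrary: x)
  case Nil
  then show ?case
    by (simp add: cayley_path_def pre_digraph.awalk_def pre_digraph.cas.simps cayley_graph_def)
next
  case (Cons s w)
  then have "s \<in> carrier G" "word_eval G w \<in> carrier G" by auto
  with Cons.IH[of "x \<otimes> s"] Cons.prems show ?case
    by (auto simp: cayley_path_def pre_digraph.awalk_def pre_digraph.cas.simps cayley_graph_def m_assoc)
qed

text \<open>Replaces oriented simplicial paths by a start vertex and a word, so that all later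
  arguments concern words only.\<close>

lemma cayley_path_conv:
  assumes "S \<subseteq> carrier G"
  shows "cayley_path G S x p y \<longleftrightarrow>
    (\<exists>w. x \<in> carrier G \<and> set w \<subseteq> S \<and> p = path_of x w \<and> y = x \<otimes> word_eval G w)"
proof
  show "cayley_path G S x p y \<Longrightarrow>
    \<exists>w. x \<in> carrier G \<and> set w \<subseteq> S \<and> p = path_of x w \<and> y = x \<otimes> word_eval G w"
  proof (induction p arbitrary: x)
    case Nil
    then show ?case
      by (intro exI[of _ "[]"])
        (auto simp add: cayley_path_def pre_digraph.awalk_def pre_digraph.cas.simps cayley_graph_def)
  next
    case (Cons e p)
    obtain g s where e: "e = (g, s)" by (cases e)
    have g: "g = x" "x \<in> carrier G" "s \<in> S" and s: "s \<in> carrier G"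
      and p: "cayley_path G S (x \<otimes> s) p y"
      using Cons.prems assms e
      by (auto simp: cayley_path_def pre_digraph.awalk_def pre_digraph.cas.simps cayley_graph_def)
    from Cons.IH[OF p] obtain w where
      w: "set w \<subseteq> S" "p = path_of (x \<otimes> s) w" "y = x \<otimes> s \<otimes> word_eval G w" by blast
    moreover have "word_eval G w \<in> carrier G" using w assms by auto
    ultimately show ?case using e g s by (intro exI[of _ "s # w"]) (auto simp: m_assoc)
  qed
qed (use assms cayley_path_path_of in blast)

lemma path_verts_path_of:
  "x \<in> carrier G \<Longrightarrow> set w \<subseteq> carrier G \<Longrightarrow>
    path_verts G S x (path_of x w) = {x \<otimes> word_eval G (take i w) | i. i \<le> length w}"
proof (induction w arbitrary: x)
  case Nil
  then show ?case by (simp add: path_verts_def pre_digraph.awalk_verts.simps)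
next
  case (Cons s w)
  have "path_verts G S x (path_of x (s # w)) = insert x (path_verts G S (x \<otimes> s) (path_of (x \<otimes> s) w))"
    by (simp add: path_verts_def pre_digraph.awalk_verts.simps cayley_graph_def)
  also have "\<dots> = insert x {x \<otimes> s \<otimes> word_eval G (take i w) | i. i \<le> length w}"
    using Cons by simp
  also have "\<dots> = {x \<otimes> word_eval G (take i (s # w)) | i. i \<le> length (s # w)}" (is "?A = ?B")
  proof
    have tk: "word_eval G (take i w) \<in> carrier G" for i
      using Cons.prems set_take_subset[of i w] by auto
    show "?A \<subseteq> ?B"
    proof
      fix v assume "v \<in> ?A"
      then consider "v = x" | i where "v = x \<otimes> s \<otimes> word_eval G (take i w)" "i \<le> length w" by auto
      then show "v \<in> ?B"
      proof cases
        case 1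
        then show ?thesis using Cons.prems by (auto intro!: exI[of _ 0])
      next
        case 2
        then show ?thesis using Cons.prems tk by (auto simp: m_assoc intro!: exI[of _ "Suc i"])
      qed
    qed
    show "?B \<subseteq> ?A"
    proof
      fix v assume "v \<in> ?B"
      then obtain i where i: "v = x \<otimes> word_eval G (take i (s # w))" "i \<le> Suc (length w)" by auto
      show "v \<in> ?A"
        using i Cons.prems tk by (cases i) (auto simp: m_assoc)
    qed
  qed
  finally show ?case .
qed

end

section \<open>Word length of a symmetric generating set\<close>

locale word_group = group G for G (structure) +
  fixes S :: "'a set"
  assumes gen: "sym_generating_set G S"
begin

abbreviation "val \<equiv> word_eval G"
abbreviation "len \<equiv> word_length G S"
abbreviation "cdist \<equiv> cayley_dist G S"

lemma S_finite [simp]: "finite S" and S_carrier: "S \<subseteq> carrier G"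
  and S_inv: "s \<in> S \<Longrightarrow> inv s \<in> S"
  using gen by (auto simp: sym_generating_set_def)

lemma val_closed [simp, intro]: "set w \<subseteq> S \<Longrightarrow> val w \<in> carrier G"
  using S_carrier by auto

lemma val_append: "set u \<subseteq> S \<Longrightarrow> set v \<subseteq> S \<Longrightarrow> val (u @ v) = val u \<otimes> val v"
  using S_carrier by (intro word_eval_append) auto

lemma rev_map_inv:
  "set t \<subseteq> S \<Longrightarrow> set (rev (map (m_inv G) t)) \<subseteq> S"
  using S_inv by auto

lemma val_rev_map_inv: "set t \<subseteq> S \<Longrightarrow> val (rev (map (m_inv G) t)) = inv (val t)"
proof (induction t)
  case (Cons s t)
  have c: "s \<in> carrier G" "val t \<in> carrier G" using Cons.prems S_carrier by auto
  then show ?case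
    using Cons rev_map_inv[of t] S_inv by (simp add: val_append inv_mult_group)
qed simp

lemma ex_word: assumes "a \<in> carrier G" shows "\<exists>w. set w \<subseteq> S \<and> val w = a"
proof -
  have "a \<in> generate G S" using assms gen by (simp add: sym_generating_set_def)
  then show ?thesis
  proof (induction rule: generate.induct)
    case one
    then show ?case by (intro exI[of _ "[]"]) auto
  next
    case (incl h)
    then show ?case using S_carrier by (intro exI[of _ "[h]"]) auto
  next
    case (inv h)
    then show ?case using S_carrier S_inv[of h] by (intro exI[of _ "[inv h]"]) auto
  next
    case (eng h1 h2)
    then obtain w1 w2 where "set w1 \<subseteq> S" "val w1 = h1" "set w2 \<subseteq> S" "val w2 = h2" by blast
    then show ?case by (intro exI[of _ "w1 @ w2"]) (auto simp: val_append)
  qed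
qed

lemma len_word:
  assumes "a \<in> carrier G"
  obtains w where "set w \<subseteq> S" "length w = len a" "val w = a"
proof -
  have "\<exists>w\<in>lists S. length w = len a \<and> val w = a"
    unfolding word_length_def
    by (rule LeastI_ex) (use ex_word[OF assms] in auto)
  with that show thesis by auto
qed

lemma len_le: "set w \<subseteq> S \<Longrightarrow> len (val w) \<le> length w"
  unfolding word_length_def by (rule Least_le) auto

lemma len_one [simp]: "len \<one> = 0"
  using len_le[of "[]"] by simp

lemma len_gen: "s \<in> S \<Longrightarrow> len s \<le> 1"
  using len_le[of "[s]"] S_carrier by auto

lemma len_mult:
  assumes "a \<in> carrier G" "b \<in> carrier G"
  shows "len (a \<otimes> b) \<le> len a + len b"
proof -
  obtain u v where "set u \<subseteq> S" "length u = len a" "val u = a" "set v \<subseteq> S" "length v = len b" "val v = b"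
    using len_word assms by metis
  then show ?thesis using len_le[of "u @ v"] by (simp add: val_append)
qed

lemma len_inv_le: assumes "a \<in> carrier G" shows "len (inv a) \<le> len a"
proof -
  obtain u where u: "set u \<subseteq> S" "length u = len a" "val u = a" using len_word assms by metis
  then show ?thesis using len_le[OF rev_map_inv[OF u(1)]] val_rev_map_inv[of u] by simp
qed

lemma len_inv: assumes "a \<in> carrier G" shows "len (inv a) = len a"
  using len_inv_le[of a] len_inv_le[of "inv a"] assms by simp

lemma finite_ball: "finite {a \<in> carrier G. len a \<le> M}"
proof -
  have "{a \<in> carrier G. len a \<le> M} \<subseteq> val ` {w. set w \<subseteq> S \<and> length w \<le> M}"
    by (auto simp: image_iff) (metis len_word)
  then show ?thesis using finite_lists_length_le[OF S_finite] finite_subset by blast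
qed

lemma geodesic_split:
  assumes "set u \<subseteq> S" "set v \<subseteq> S" "len (val (u @ v)) = length (u @ v)"
  shows "len (val u) = length u" "len (val v) = length v"
  using len_mult[of "val u" "val v"] len_le[of u] len_le[of v] assms by (auto simp: val_append)

lemma dist_mult_right:
  assumes "x \<in> carrier G" "y \<in> carrier G"
  shows "cdist x (x \<otimes> y) = len y"
  using assms by (simp add: cayley_dist_def m_assoc[symmetric])

lemma dist_self: "x \<in> carrier G \<Longrightarrow> cdist x x = 0"
  by (simp add: cayley_dist_def)

lemma dist_sym:
  assumes "x \<in> carrier G" "y \<in> carrier G"
  shows "cdist x y = cdist y x"
proof -
  have "inv y \<otimes> x = inv (inv x \<otimes> y)" using assms by (simp add: inv_mult_group)
  then show ?thesis using assms len_inv[of "inv x \<otimes> y"] by (simp add: cayley_dist_def)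
qed

lemma inv_mult_cancel3:
  assumes "x \<in> carrier G" "y \<in> carrier G" "z \<in> carrier G"
  shows "(inv x \<otimes> y) \<otimes> (inv y \<otimes> z) = inv x \<otimes> z"
proof -
  have "(inv x \<otimes> y) \<otimes> (inv y \<otimes> z) = inv x \<otimes> (y \<otimes> inv y) \<otimes> z"
    using assms by (simp only: m_assoc m_closed inv_closed)
  then show ?thesis using assms by simp
qed

lemma mult_inv_cancel:
  assumes "x \<in> carrier G" "y \<in> carrier G"
  shows "x \<otimes> (inv x \<otimes> y) = y"
  using assms by (simp add: m_assoc[symmetric])

lemma dist_tri:
  assumes "x \<in> carrier G" "y \<in> carrier G" "z \<in> carrier G"
  shows "cdist x z \<le> cdist x y + cdist y z"
  using len_mult[of "inv x \<otimes> y" "inv y \<otimes> z"] assms inv_mult_cancel3 by (simp add: cayley_dist_def)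

lemma geodesic_path_of:
  assumes "x \<in> carrier G" "set w \<subseteq> S" "len (val w) = length w"
  shows "cayley_geodesic G S x (path_of x w) (x \<otimes> val w)"
  unfolding cayley_geodesic_def using assms S_carrier
  by (simp add: cayley_path_path_of dist_mult_right)

lemma geodesic_word_between:
  assumes "x \<in> carrier G" "set w \<subseteq> S" "len (val w) = length w" "i \<le> length w"
  shows "cdist x (x \<otimes> val (take i w)) = i"
    and "cdist (x \<otimes> val (take i w)) (x \<otimes> val w) = length w - i"
proof -
  have st: "set (take i w) \<subseteq> S" "set (drop i w) \<subseteq> S"
    using assms(2) by (auto dest: in_set_takeD in_set_dropD)
  have l: "len (val (take i w)) = i" "len (val (drop i w)) = length w - i"
    using geodesic_split[OF st] assms(3,4) by auto
  show "cdist x (x \<otimes> val (take i w)) = i" using assms st l by (simp add: dist_mult_right)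
  have "val w = val (take i w) \<otimes> val (drop i w)" using val_append[OF st] by simp
  then have "x \<otimes> val w = (x \<otimes> val (take i w)) \<otimes> val (drop i w)"
    using assms st by (simp add: m_assoc)
  then show "cdist (x \<otimes> val (take i w)) (x \<otimes> val w) = length w - i"
    using assms st l by (simp add: dist_mult_right)
qed

lemma dist_word:
  assumes "x \<in> carrier G" "y \<in> carrier G"
  obtains w where "set w \<subseteq> S" "length w = cdist x y" "x \<otimes> val w = y" "len (val w) = length w"
proof -
  obtain w where w: "set w \<subseteq> S" "length w = len (inv x \<otimes> y)" "val w = inv x \<otimes> y"
    using len_word assms by (metis inv_closed m_closed)
  then show thesis using that[of w] assms by (simp add: cayley_dist_def mult_inv_cancel)
qed

lemma path_verts_geodesic:
  assumes "x \<in> carrier G" "set w \<subseteq> S" "len (val w) = length w" "v \<in> path_verts G S x (path_of x w)"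
  shows "v \<in> carrier G" "cdist x v + cdist v (x \<otimes> val w) = cdist x (x \<otimes> val w)"
proof -
  obtain i where i: "v = x \<otimes> val (take i w)" "i \<le> length w"
    using assms S_carrier path_verts_path_of[of x w S] by auto
  show "v \<in> carrier G" using i assms set_take_subset[of i w] by auto
  show "cdist x v + cdist v (x \<otimes> val w) = cdist x (x \<otimes> val w)"
    using geodesic_word_between[OF assms(1-3) i(2)] i assms by (simp add: dist_mult_right)
qed

text \<open>A point \<open>u\<close> of an interval lies on some geodesic, obtained by joining
  geodesic words from \<open>x\<close> to \<open>u\<close> and from \<open>u\<close> to
  \<open>y\<close>. Thinness of all geodesic triangles thus yields the interval form.\<close>

lemma hyperbolic_metric:
  assumes "hyperbolic_cayley_graph G S"
  obtains \<delta> where "hyperbolic_nat_metric (carrier G) cdist \<delta>"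
proof -
  obtain \<delta> where \<delta>: "\<And>x y z p q r u.
        cayley_geodesic G S x p y \<Longrightarrow> cayley_geodesic G S y q z \<Longrightarrow> cayley_geodesic G S x r z \<Longrightarrow>
        u\<in>path_verts G S x p \<Longrightarrow> \<exists>v\<in>path_verts G S y q \<union> path_verts G S x r. cdist u v \<le> \<delta>"
    using assms unfolding hyperbolic_cayley_graph_def by blast
  have "hyperbolic_nat_metric (carrier G) cdist \<delta>"
  proof
    fix x y :: 'a and k :: nat
    assume xy: "x \<in> carrier G" "y \<in> carrier G" "k \<le> cdist x y"
    obtain w where w: "set w \<subseteq> S" "length w = cdist x y" "x \<otimes> val w = y" "len (val w) = length w"
      using dist_word xy by metis
    have "x \<otimes> val (take k w) \<in> carrier G" using xy w set_take_subset[of k w] by auto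
    then show "\<exists>z\<in>carrier G. cdist x z = k \<and> cdist z y = cdist x y - k"
      using geodesic_word_between[OF xy(1) w(1,4), of k] w xy by auto
  next
    fix x y z u
    assume c: "x \<in> carrier G" "y \<in> carrier G" "z \<in> carrier G" "u \<in> carrier G"
      and u: "cdist x u + cdist u y = cdist x y"
    obtain w1 where w1: "set w1 \<subseteq> S" "length w1 = cdist x u" "x \<otimes> val w1 = u" "len (val w1) = length w1"
      using dist_word c by metis
    obtain w2 where w2: "set w2 \<subseteq> S" "length w2 = cdist u y" "u \<otimes> val w2 = y" "len (val w2) = length w2"
      using dist_word c by metis
    obtain q where q: "set q \<subseteq> S" "y \<otimes> val q = z" "len (val q) = length q"
      using dist_word c by metis
    obtain r where r: "set r \<subseteq> S" "x \<otimes> val r = z" "len (val r) = length r"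
      using dist_word c by metis
    define p where "p = w1 @ w2"
    have p: "set p \<subseteq> S" "x \<otimes> val p = y"
      using w1 w2 c by (auto simp: p_def val_append m_assoc[symmetric])
    have "len (val p) = cdist x y" using p c by (metis dist_mult_right val_closed)
    then have pl: "len (val p) = length p" using u w1 w2 by (simp add: p_def)
    have "u \<in> path_verts G S x (path_of x p)"
    proof -
      have "set p \<subseteq> carrier G" using p S_carrier by blast
      then have "path_verts G S x (path_of x p) = {x \<otimes> val (take i p) | i. i \<le> length p}"
        using path_verts_path_of c by blast
      moreover have "take (length w1) p = w1" "length w1 \<le> length p" by (auto simp: p_def)
      ultimately show ?thesis using w1(3) by (metis (mono_tags, lifting) mem_Collect_eq)
    qed
    then obtain v where v: "v\<in>path_verts G S y (path_of y q) \<union> path_verts G S x (path_of x r)" "cdist u v \<le> \<delta>"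
      using \<delta>[of x "path_of x p" y "path_of y q" z "path_of x r" u]
        geodesic_path_of[OF c(1) p(1) pl] geodesic_path_of[OF c(2) q(1,3)]
        geodesic_path_of[OF c(1) r(1,3)] p q r by auto
    then show "\<exists>v\<in>carrier G. (cdist x v + cdist v z = cdist x z \<or> cdist y v + cdist v z = cdist y z) \<and> cdist u v \<le> \<delta>"
      using path_verts_geodesic[OF c(2) q(1,3), of v] path_verts_geodesic[OF c(1) r(1,3), of v] q r by auto
  qed (use dist_self dist_sym dist_tri in auto)
  with that show thesis by blast
qed

lemma len_comparison:
  assumes "sym_generating_set G T"
  obtains A where "\<And>a. a \<in> carrier G \<Longrightarrow> len a \<le> A * word_length G T a"
proof -
  interpret T: word_group G T by unfold_locales (rule assms)
  \<comment> \<open>The inserted 0 covers an empty \<open>T\<close>, for which \<open>Max\<close>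
    would be unspecified.\<close>
  define A where "A = Max (insert 0 (len ` T))"
  have A: "len t \<le> A" if "t \<in> T" for t unfolding A_def using that by (intro Max_ge) auto
  have *: "len (val w) \<le> A * length w" if "set w \<subseteq> T" for w
    using that
  proof (induction w)
    case (Cons t w)
    then have "len (t \<otimes> val w) \<le> len t + len (val w)"
      using T.S_carrier by (intro len_mult) auto
    with Cons A[of t] show ?case by auto
  qed simp
  have "len a \<le> A * T.len a" if "a \<in> carrier G" for a
    using T.len_word[OF that] * by metis
  with that show thesis by blast
qed

end

lemma bilip_change_metric:
  assumes "bilip d \<kappa> N f" "\<And>i. i \<le> N \<Longrightarrow> f i \<in> X"
    and "\<And>x y. x \<in> X \<Longrightarrow> y \<in> X \<Longrightarrow> d x y \<le> A * e x y"
    and "\<And>x y. x \<in> X \<Longrightarrow> y \<in> X \<Longrightarrow> e x y \<le> B * d x y"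
  shows "bilip e (\<kappa> * (A + B)) N f"
  unfolding bilip_def
proof (intro allI impI conjI)
  fix i j assume ij: "i \<le> j" "j \<le> N"
  have X: "f i \<in> X" "f j \<in> X" using assms ij by auto
  have "j - i \<le> \<kappa> * d (f i) (f j)" using assms(1) ij by (simp add: bilip_def)
  also have "\<dots> \<le> \<kappa> * (A * e (f i) (f j))" using assms(3) X by (intro mult_le_mono2) auto
  also have "\<dots> \<le> \<kappa> * (A + B) * e (f i) (f j)" by (simp add: algebra_simps)
  finally show "j - i \<le> \<kappa> * (A + B) * e (f i) (f j)" .
  have "e (f i) (f j) \<le> B * d (f i) (f j)" using assms X by auto
  also have "\<dots> \<le> B * (\<kappa> * (j - i))" using assms(1) ij by (intro mult_le_mono2) (simp add: bilip_def)
  also have "\<dots> \<le> \<kappa> * (A + B) * (j - i)" by (simp add: algebra_simps)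
  finally show "e (f i) (f j) \<le> \<kappa> * (A + B) * (j - i)" .
qed

section \<open>Fellow travelling under a change of generators\<close>

context word_group
begin

text \<open>The sequences are read in the metric of \<open>T\<close>, where they are bilipschitz
  with constant \<open>\<kappa> * (A + B)\<close> and their ends are at most \<open>B * c\<close>
  apart; the resulting bound is multiplied by \<open>A\<close> on the way back.\<close>

lemma hyperbolic_fellow_travel:
  assumes "word_hyperbolic G"
  obtains M where "\<And>N f N' f' i. (\<And>i. i \<le> N \<Longrightarrow> f i \<in> carrier G) \<Longrightarrow> bilip cdist \<kappa> N f \<Longrightarrow>
     (\<And>i. i \<le> N' \<Longrightarrow> f' i \<in> carrier G) \<Longrightarrow> bilip cdist \<kappa> N' f' \<Longrightarrow>
     f 0 = f' 0 \<Longrightarrow> cdist (f N) (f' N') \<le> c \<Longrightarrow> i \<le> N \<Longrightarrow> \<exists>j\<le>N'. cdist (f i) (f' j) \<le> M"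
proof -
  obtain T where T: "sym_generating_set G T" "hyperbolic_cayley_graph G T"
    using assms unfolding word_hyperbolic_def by blast
  interpret T: word_group G T by unfold_locales (rule T(1))
  obtain A where "\<And>a. a \<in> carrier G \<Longrightarrow> len a \<le> A * T.len a" using len_comparison[OF T(1)] by metis
  then have A: "cdist x y \<le> A * T.cdist x y" if "x \<in> carrier G" "y \<in> carrier G" for x y
    using that by (simp add: cayley_dist_def)
  obtain B where "\<And>a. a \<in> carrier G \<Longrightarrow> T.len a \<le> B * len a" using T.len_comparison[OF gen] by metis
  then have B: "T.cdist x y \<le> B * cdist x y" if "x \<in> carrier G" "y \<in> carrier G" for x y
    using that by (simp add: cayley_dist_def)
  obtain \<delta> where "hyperbolic_nat_metric (carrier G) T.cdist \<delta>" using T.hyperbolic_metric[OF T(2)] by metis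
  then interpret hyperbolic_nat_metric "carrier G" T.cdist \<delta> .
  obtain M where M: "\<And>N f N' f' i. (\<And>i. i \<le> N \<Longrightarrow> f i \<in> carrier G) \<Longrightarrow> bilip T.cdist (\<kappa> * (A + B)) N f \<Longrightarrow>
     (\<And>i. i \<le> N' \<Longrightarrow> f' i \<in> carrier G) \<Longrightarrow> bilip T.cdist (\<kappa> * (A + B)) N' f' \<Longrightarrow>
     f 0 = f' 0 \<Longrightarrow> T.cdist (f N) (f' N') \<le> B * c \<Longrightarrow> i \<le> N \<Longrightarrow> \<exists>j\<le>N'. T.cdist (f i) (f' j) \<le> M"
    using bilip_fellow_travel by metis
  have "\<exists>j\<le>N'. cdist (f i) (f' j) \<le> A * M"
    if f: "\<And>i. i \<le> N \<Longrightarrow> f i \<in> carrier G" and bl: "bilip cdist \<kappa> N f"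
      and f': "\<And>i. i \<le> N' \<Longrightarrow> f' i \<in> carrier G" and bl': "bilip cdist \<kappa> N' f'"
      and e: "f 0 = f' 0" "cdist (f N) (f' N') \<le> c" and i: "i \<le> N" for N f N' f' i
  proof -
    have "bilip T.cdist (\<kappa> * (A + B)) N f" "bilip T.cdist (\<kappa> * (A + B)) N' f'"
      using bilip_change_metric[OF bl f A B] bilip_change_metric[OF bl' f' A B] by auto
    moreover have "T.cdist (f N) (f' N') \<le> B * c"
      using B[of "f N" "f' N'"] f f' e(2) by (meson le_refl mult_le_mono2 order_trans)
    ultimately obtain j where j: "j \<le> N'" "T.cdist (f i) (f' j) \<le> M"
      using M[of N f N' f' i] f f' e i by blast
    then have "cdist (f i) (f' j) \<le> A * M"
      using A[of "f i" "f' j"] f f' i by (meson mult_le_mono2 order_trans)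
    with j show ?thesis by blast
  qed
  with that show thesis by blast
qed

end

subsection \<open>Weighted norms\<close>

text \<open>Letters are pairs of an element and a cost, not elements with a cost function, because
  the value of a copy of \<sigma> may coincide with a generator that has a different weight.\<close>

definition weighted_norm :: "('a, 'b) monoid_scheme \<Rightarrow> ('a \<times> nat) set \<Rightarrow> 'a \<Rightarrow> nat" where
  "weighted_norm G W a =
     (LEAST k. \<exists>ws. set ws \<subseteq> W \<and> sum_list (map snd ws) = k \<and> word_eval G (map fst ws) = a)"

text \<open>Makes everything shown for weighted norms available for word length, as the construction
  of a combing requires.\<close>

lemma weighted_norm_unit_weights: "weighted_norm G (S \<times> {1}) a = word_length G S a"
proof -
  have *: "(\<exists>ws. set ws \<subseteq> S \<times> {1} \<and> sum_list (map snd ws) = k \<and> word_eval G (map fst ws) = a) \<longleftrightarrow>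
        (\<exists>w\<in>lists S. length w = k \<and> word_eval G w = a)" for k
  proof
    assume "\<exists>ws. set ws \<subseteq> S \<times> {1} \<and> sum_list (map snd ws) = k \<and> word_eval G (map fst ws) = a"
    then obtain ws :: "('a \<times> nat) list" where
      ws: "set ws \<subseteq> S \<times> {1}" "sum_list (map snd ws) = k" "word_eval G (map fst ws) = a" by blast
    have "sum_list (map snd ws) = length ws"
      using ws(1) by (induction ws) auto
    then show "\<exists>w\<in>lists S. length w = k \<and> word_eval G w = a"
      using ws by (intro bexI[of _ "map fst ws"]) fastforce+
  next
    assume "\<exists>w\<in>lists S. length w = k \<and> word_eval G w = a"
    then obtain w where "w \<in> lists S" "length w = k" "word_eval G w = a" by blast
    then show "\<exists>ws. set ws \<subseteq> S \<times> {1} \<and> sum_list (map snd ws) = k \<and> word_eval G (map fst ws) = a"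
      by (intro exI[of _ "map (\<lambda>s. (s, 1)) w"]) (auto simp: comp_def sum_list_triv)
  qed
  then show ?thesis unfolding weighted_norm_def word_length_def by simp
qed

context word_group
begin

lemma bilip_geodesic_word:
  assumes "set w \<subseteq> S" "len (val w) = length w" "1 \<le> \<kappa>"
  shows "bilip cdist \<kappa> (length w) (\<lambda>i. val (take i w))"
proof -
  have "cdist (val (take i w)) (val (take j w)) = j - i" if ij: "i \<le> j" "j \<le> length w" for i j
  proof -
    have tj: "set (take j w) \<subseteq> S" "set (drop j w) \<subseteq> S"
      using assms(1) by (auto dest: in_set_takeD in_set_dropD)
    have "len (val (take j w)) = length (take j w)"
      using geodesic_split(1)[OF tj] assms(2) by simp
    from geodesic_word_between(2)[OF one_closed tj(1) this, of i] ij
    show ?thesis using tj assms(1) in_set_takeD[of _ i w] by (simp add: min_absorb1 subset_iff)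
  qed
  then show ?thesis using assms(3) unfolding bilip_def by auto
qed

text \<open>Fellow travelling gives a nearby prefix of \<open>x @ v\<close> of unknown length
  \<open>j\<close>. Both words are geodesic from the identity, so \<open>j\<close> differs from
  \<open>length w\<close> by at most \<open>M\<close>; comparison at equal length costs
  \<open>2 * M\<close>.\<close>

lemma geodesic_words_fellow_travel:
  assumes "word_hyperbolic G"
  obtains M where "\<And>w u x v. set w \<subseteq> S \<Longrightarrow> set u \<subseteq> S \<Longrightarrow> set x \<subseteq> S \<Longrightarrow> set v \<subseteq> S \<Longrightarrow>
    length x = length w \<Longrightarrow> val (w @ u) = val (x @ v) \<Longrightarrow>
    len (val (w @ u)) = length (w @ u) \<Longrightarrow> len (val (x @ v)) = length (x @ v) \<Longrightarrow>
    len (inv (val w) \<otimes> val x) \<le> M"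
proof -
  obtain M where M: "\<And>N f N' f' i. (\<And>i. i \<le> N \<Longrightarrow> f i \<in> carrier G) \<Longrightarrow> bilip cdist 1 N f \<Longrightarrow>
     (\<And>i. i \<le> N' \<Longrightarrow> f' i \<in> carrier G) \<Longrightarrow> bilip cdist 1 N' f' \<Longrightarrow>
     f 0 = f' 0 \<Longrightarrow> cdist (f N) (f' N') \<le> 0 \<Longrightarrow> i \<le> N \<Longrightarrow> \<exists>j\<le>N'. cdist (f i) (f' j) \<le> M"
    using hyperbolic_fellow_travel[OF assms] by metis
  have "len (inv (val w) \<otimes> val x) \<le> 2 * M"
    if S: "set w \<subseteq> S" "set u \<subseteq> S" "set x \<subseteq> S" "set v \<subseteq> S" and l: "length x = length w"
      and e: "val (w @ u) = val (x @ v)"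
      and g: "len (val (w @ u)) = length (w @ u)" "len (val (x @ v)) = length (x @ v)" for w u x v
  proof -
    define f f' where "f i = val (take i (w @ u))" and "f' i = val (take i (x @ v))" for i
    have S': "set (take i (w @ u)) \<subseteq> S" "set (take i (x @ v)) \<subseteq> S" for i
      using S by (auto simp del: take_append dest!: in_set_takeD)
    then have c: "f i \<in> carrier G" "f' i \<in> carrier G" for i by (auto simp: f_def f'_def simp del: take_append)
    have bl: "bilip cdist 1 (length (w @ u)) f" "bilip cdist 1 (length (x @ v)) f'"
      using bilip_geodesic_word[of "w @ u" 1] bilip_geodesic_word[of "x @ v" 1] S g
      unfolding f_def f'_def by (simp_all del: take_append)
    have ends: "f 0 = f' 0" "f (length (w @ u)) = f' (length (x @ v))"
      using e by (simp_all add: f_def f'_def)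
    obtain j where j: "j \<le> length (x @ v)" "cdist (f (length w)) (f' j) \<le> M"
      using M[OF c(1) bl(1) c(2) bl(2), of "length w"] ends c dist_self by auto
    have lens: "cdist (f' 0) (f' i) = i" if "i \<le> length (x @ v)" for i
    proof -
      have "cdist \<one> (\<one> \<otimes> val (take i (x @ v))) = i"
        using S g(2) that by (intro geodesic_word_between(1)) auto
      then show ?thesis using S' c unfolding f'_def by (simp del: take_append)
    qed
    have lenw: "cdist (f' 0) (f (length w)) = length w"
    proof -
      have "cdist \<one> (\<one> \<otimes> val (take (length w) (w @ u))) = length w"
        using S g(1) by (intro geodesic_word_between(1)) auto
      then show ?thesis using S' c unfolding f'_def f_def by (simp del: take_append)
    qed
    have btw: "cdist (f' a) (f' b) \<le> b - a" if "a \<le> b" "b \<le> length (x @ v)" for a b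
      using bl(2) that unfolding bilip_def by (metis mult_1)
    have lx: "length x \<le> length (x @ v)" by simp
    have "cdist (f' j) (f' (length x)) \<le> M"
    proof (cases "j \<le> length x")
      case True
      have "length w \<le> j + M"
        using dist_tri[OF c(2)[of 0] c(2)[of j] c(1)[of "length w"]] dist_sym[OF c(1)[of "length w"] c(2)[of j]]
          lens[OF j(1)] lenw j by linarith
      then show ?thesis using btw[OF True lx] l by linarith
    next
      case False
      have "j \<le> length w + M"
        using dist_tri[OF c(2)[of 0] c(1)[of "length w"] c(2)[of j]] lens[OF j(1)] lenw j by linarith
      then show ?thesis using btw[of "length x" j] j(1) l False
          dist_sym[OF c(2)[of j] c(2)[of "length x"]] by linarith
    qed
    then have "cdist (f (length w)) (f' (length x)) \<le> 2 * M"
      using dist_tri[OF c(1)[of "length w"] c(2)[of j] c(2)[of "length x"]] j by linarith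
    then show ?thesis by (simp add: f_def f'_def cayley_dist_def)
  qed
  with that show thesis by blast
qed

end

text \<open>Positive weights bound the number of letters by the cost, and \<open>K\<close> bounds
  the length of each letter: together they make minimal words quasi-geodesic. Unit weights on
  \<open>S\<close> keep the norm below the word length.\<close>

locale weighted_word_group = word_group +
  fixes W :: "('a \<times> nat) set" and K :: nat
  assumes W_wf: "(a, k) \<in> W \<Longrightarrow> a \<in> carrier G \<and> 1 \<le> k \<and> len a \<le> K"
    and S_W: "s \<in> S \<Longrightarrow> (s, 1) \<in> W"
begin

abbreviation "nrm \<equiv> weighted_norm G W"
abbreviation "wval ws \<equiv> val (map fst ws)"
abbreviation "wt ws \<equiv> sum_list (map snd ws)"

lemma W_carrier: "set ws \<subseteq> W \<Longrightarrow> set (map fst ws) \<subseteq> carrier G"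
  using W_wf by auto

lemma wval_closed: "set ws \<subseteq> W \<Longrightarrow> wval ws \<in> carrier G"
  using W_carrier by (intro word_eval_closed)

lemma wval_append: "set u \<subseteq> W \<Longrightarrow> set v \<subseteq> W \<Longrightarrow> wval (u @ v) = wval u \<otimes> wval v"
  using W_carrier[of u] W_carrier[of v] word_eval_append by simp

lemma word_as_weighted:
  "set w \<subseteq> S \<Longrightarrow> \<exists>ws. set ws \<subseteq> W \<and> wt ws = length w \<and> wval ws = val w"
  using S_W by (intro exI[of _ "map (\<lambda>s. (s, 1)) w"]) (auto simp: comp_def sum_list_triv)

lemma norm_le: "set ws \<subseteq> W \<Longrightarrow> nrm (wval ws) \<le> wt ws"
  unfolding weighted_norm_def by (rule Least_le) auto

lemma norm_word:
  assumes "a \<in> carrier G"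
  obtains ws where "set ws \<subseteq> W" "wt ws = nrm a" "wval ws = a"
proof -
  obtain w where "set w \<subseteq> S" "val w = a" using ex_word assms by blast
  then have ex: "\<exists>k ws. set ws \<subseteq> W \<and> wt ws = k \<and> wval ws = a" using word_as_weighted by metis
  have "\<exists>ws. set ws \<subseteq> W \<and> wt ws = nrm a \<and> wval ws = a"
    unfolding weighted_norm_def by (rule LeastI_ex[OF ex])
  with that show thesis by blast
qed

lemma norm_mult:
  assumes "a \<in> carrier G" "b \<in> carrier G"
  shows "nrm (a \<otimes> b) \<le> nrm a + nrm b"
proof -
  obtain u v where "set u \<subseteq> W" "wt u = nrm a" "wval u = a" "set v \<subseteq> W" "wt v = nrm b" "wval v = b"
    using norm_word assms by metis
  then show ?thesis using norm_le[of "u @ v"] wval_append[of u v] by simp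
qed

lemma norm_le_len: assumes "a \<in> carrier G" shows "nrm a \<le> len a"
proof -
  obtain w where "set w \<subseteq> S" "length w = len a" "val w = a" using len_word assms by metis
  then show ?thesis using word_as_weighted norm_le by metis
qed

lemma length_le_wt: "set ws \<subseteq> W \<Longrightarrow> length ws \<le> wt ws"
proof (induction ws)
  case (Cons p ws)
  then show ?case using W_wf[of "fst p" "snd p"] by auto
qed simp

lemma len_wval: "set ws \<subseteq> W \<Longrightarrow> len (wval ws) \<le> K * length ws"
proof (induction ws)
  case (Cons p ws)
  have p: "fst p \<in> carrier G" "len (fst p) \<le> K" using Cons W_wf[of "fst p" "snd p"] by auto
  show ?case using len_mult[OF p(1) wval_closed[of ws]] p Cons by auto
qed simp

lemma norm_right_lipschitz:
  assumes "a \<in> carrier G" "b \<in> carrier G"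
  shows "\<bar>int (nrm (a \<otimes> b)) - int (nrm a)\<bar> \<le> int (len b)"
proof -
  have "(a \<otimes> b) \<otimes> inv b = a" using assms by (simp add: m_assoc)
  then have "nrm a \<le> nrm (a \<otimes> b) + nrm (inv b)" using norm_mult[of "a \<otimes> b" "inv b"] assms by simp
  moreover have "nrm (a \<otimes> b) \<le> nrm a + nrm b" using norm_mult assms by simp
  moreover have "nrm b \<le> len b" "nrm (inv b) \<le> len b"
    using norm_le_len[of b] norm_le_len[of "inv b"] len_inv assms by auto
  ultimately show ?thesis by linarith
qed

lemma norm_left_lipschitz:
  assumes "a \<in> carrier G" "b \<in> carrier G"
  shows "\<bar>int (nrm (b \<otimes> a)) - int (nrm a)\<bar> \<le> int (len b)"
proof -
  have "inv b \<otimes> (b \<otimes> a) = a" using assms by (simp add: m_assoc[symmetric])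
  then have "nrm a \<le> nrm (inv b) + nrm (b \<otimes> a)" using norm_mult[of "inv b" "b \<otimes> a"] assms by simp
  moreover have "nrm (b \<otimes> a) \<le> nrm b + nrm a" using norm_mult assms by simp
  moreover have "nrm b \<le> len b" "nrm (inv b) \<le> len b"
    using norm_le_len[of b] norm_le_len[of "inv b"] len_inv assms by auto
  ultimately show ?thesis by linarith
qed

text \<open>By subadditivity, a cheaper word for one factor would make the whole cheaper.\<close>

lemma minimal_subword:
  assumes "set u \<subseteq> W" "set v \<subseteq> W" "set x \<subseteq> W" "wt (u @ v @ x) = nrm (wval (u @ v @ x))"
  shows "nrm (wval u) = wt u" "nrm (wval v) = wt v" "nrm (wval x) = wt x"
proof -
  have "wval (u @ v @ x) = wval u \<otimes> (wval v \<otimes> wval x)"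
    using assms wval_append[of u "v @ x"] wval_append[of v x] by simp
  then have "nrm (wval (u @ v @ x)) \<le> nrm (wval u) + (nrm (wval v) + nrm (wval x))"
    using norm_mult[of "wval u" "wval v \<otimes> wval x"] norm_mult[of "wval v" "wval x"]
      wval_closed assms(1-3) by (simp add: order_trans[OF norm_mult])
  then show "nrm (wval u) = wt u" "nrm (wval v) = wt v" "nrm (wval x) = wt x"
    using norm_le[of u] norm_le[of v] norm_le[of x] assms by auto
qed

text \<open>The values of the prefixes of a minimal weighted word. The word between two prefixes is
  minimal too, so its number of letters is at most its weight, which is its norm and hence at most
  its length; conversely each letter moves by at most \<open>K\<close>. The constant
  \<open>Suc K\<close> is positive even if \<open>K\<close> is 0.\<close>

lemma minimal_path:
  assumes "a \<in> carrier G"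
  obtains N f where "f 0 = \<one>" "f N = a" "\<And>i. f i \<in> carrier G" "bilip cdist (Suc K) N f"
    "\<And>i. nrm a = nrm (f i) + nrm (inv (f i) \<otimes> a)"
proof -
  obtain ws where ws: "set ws \<subseteq> W" "wt ws = nrm a" "wval ws = a" using norm_word[OF assms] by metis
  define f where "f i = wval (take i ws)" for i
  have tW: "set (take i ws) \<subseteq> W" "set (drop i ws) \<subseteq> W" for i
    using ws(1) by (auto dest: in_set_takeD in_set_dropD)
  have c: "f i \<in> carrier G" for i unfolding f_def by (rule wval_closed[OF tW(1)])
  have split: "nrm a = nrm (f i) + nrm (inv (f i) \<otimes> a)" for i
  proof -
    have "a = f i \<otimes> wval (drop i ws)" using wval_append[OF tW(1)[of i] tW(2)[of i]] ws(3) by (simp add: f_def)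
    then have "inv (f i) \<otimes> a = wval (drop i ws)"
      using c wval_closed[OF tW(2)] by (simp add: m_assoc[symmetric])
    moreover have "nrm (f i) = wt (take i ws)" "nrm (wval (drop i ws)) = wt (drop i ws)"
      using minimal_subword[of "take i ws" "[]" "drop i ws"] tW ws by (auto simp: f_def)
    moreover have "wt ws = wt (take i ws) + wt (drop i ws)"
      by (metis append_take_drop_id map_append sum_list_append)
    ultimately show ?thesis using ws by simp
  qed
  have bl: "bilip cdist (Suc K) (length ws) f"
    unfolding bilip_def
  proof (intro allI impI)
    fix i j assume ij: "i \<le> j" "j \<le> length ws"
    define m where "m = take (j - i) (drop i ws)"
    have tj: "take j ws = take i ws @ m"
      using ij take_add[of i "j - i" ws] by (simp add: m_def)
    have m: "set m \<subseteq> W" "length m = j - i" using tW(1)[of j] tj ij by (auto simp: m_def)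
    have "f j = f i \<otimes> wval m" unfolding f_def tj by (rule wval_append[OF tW(1) m(1)])
    then have d: "cdist (f i) (f j) = len (wval m)" using c wval_closed[OF m(1)] by (simp add: dist_mult_right)
    have "ws = take i ws @ m @ drop j ws" using tj by (metis append_assoc append_take_drop_id)
    then have "nrm (wval m) = wt m"
      using minimal_subword(2)[OF tW(1)[of i] m(1) tW(2)[of j]] ws by simp
    then have "j - i \<le> len (wval m)"
      using length_le_wt[OF m(1)] norm_le_len[OF wval_closed[OF m(1)]] m(2) by simp
    moreover have "len (wval m) \<le> K * (j - i)" using len_wval[OF m(1)] m(2) by simp
    ultimately show "j - i \<le> Suc K * cdist (f i) (f j) \<and> cdist (f i) (f j) \<le> Suc K * (j - i)"
      using d by auto
  qed
  have "f 0 = \<one>" "f (length ws) = a" using ws by (auto simp: f_def)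
  with that c split bl show thesis by blast
qed

text \<open>The point \<open>val w \<otimes> k\<close> is where a minimal path to the end passes
  near \<open>val w\<close>. The extra \<open>t\<close> of at most one letter moves the end by at
  most 1; it is present for \<open>geodesic_continuation_transfer\<close>, where the last letter is
  not yet known to continue a geodesic.\<close>

lemma norm_splits_near_geodesic:
  assumes "word_hyperbolic G"
  obtains M where "\<And>w u t. set w \<subseteq> S \<Longrightarrow> set u \<subseteq> S \<Longrightarrow> set t \<subseteq> S \<Longrightarrow> length t \<le> 1 \<Longrightarrow>
    len (val (w @ u)) = length (w @ u) \<Longrightarrow>
    \<exists>k\<in>carrier G. len k \<le> M \<and>
      nrm (val (w @ u @ t)) = nrm (val w \<otimes> k) + nrm (inv k \<otimes> val (u @ t))"
proof -
  obtain M where M: "\<And>N f N' f' i. (\<And>i. i \<le> N \<Longrightarrow> f i \<in> carrier G) \<Longrightarrow> bilip cdist (Suc K) N f \<Longrightarrow>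
     (\<And>i. i \<le> N' \<Longrightarrow> f' i \<in> carrier G) \<Longrightarrow> bilip cdist (Suc K) N' f' \<Longrightarrow>
     f 0 = f' 0 \<Longrightarrow> cdist (f N) (f' N') \<le> 1 \<Longrightarrow> i \<le> N \<Longrightarrow> \<exists>j\<le>N'. cdist (f i) (f' j) \<le> M"
    using hyperbolic_fellow_travel[OF assms] by metis
  have "\<exists>k\<in>carrier G. len k \<le> M \<and>
      nrm (val (w @ u @ t)) = nrm (val w \<otimes> k) + nrm (inv k \<otimes> val (u @ t))"
    if S: "set w \<subseteq> S" "set u \<subseteq> S" "set t \<subseteq> S" and l: "length t \<le> 1"
      and g: "len (val (w @ u)) = length (w @ u)" for w u t
  proof -
    define a where "a = val (w @ u @ t)"
    have cl: "val w \<in> carrier G" "val u \<in> carrier G" "val t \<in> carrier G" "val (u @ t) \<in> carrier G" "a \<in> carrier G"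
      using S by (auto simp: a_def)
    define f where "f i = val (take i (w @ u))" for i
    have "set (take i (w @ u)) \<subseteq> S" for i
      using S by (auto simp del: take_append dest!: in_set_takeD)
    then have c: "f i \<in> carrier G" for i by (auto simp: f_def simp del: take_append)
    have bl: "bilip cdist (Suc K) (length (w @ u)) f"
      using bilip_geodesic_word[of "w @ u" "Suc K"] S g unfolding f_def by (simp del: take_append)
    obtain N f' where f': "f' 0 = \<one>" "f' N = a" "\<And>i. f' i \<in> carrier G" "bilip cdist (Suc K) N f'"
      "\<And>i. nrm a = nrm (f' i) + nrm (inv (f' i) \<otimes> a)"
      using minimal_path[OF cl(5)] by metis
    have fN: "f (length (w @ u)) = val (w @ u)" and fw: "f (length w) = val w" and f0: "f 0 = \<one>"
      by (simp_all add: f_def)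
    have "a = val (w @ u) \<otimes> val t" using S val_append[of "w @ u" t] by (simp add: a_def)
    then have "cdist (f (length (w @ u))) (f' N) = len (val t)"
      using fN f'(2) S dist_mult_right[of "val (w @ u)" "val t"] by simp
    also have "\<dots> \<le> 1" using len_le[OF S(3)] l by simp
    finally obtain j where j: "cdist (val w) (f' j) \<le> M"
      using M[OF c bl f'(3,4), of "length w"] f0 f'(1) fw by auto
    define k where "k = inv (val w) \<otimes> f' j"
    have k: "k \<in> carrier G" "len k \<le> M" using j cl f'(3) by (auto simp: k_def cayley_dist_def)
    have wk: "val w \<otimes> k = f' j" using cl f'(3) by (simp add: k_def mult_inv_cancel)
    have "a = val w \<otimes> val (u @ t)" using S val_append[of w "u @ t"] by (simp add: a_def)
    then have "inv (f' j) \<otimes> a = inv k \<otimes> val (u @ t)"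
      using cl f'(3)[of j] by (simp add: k_def inv_mult_group m_assoc)
    then show ?thesis using f'(5)[of j] k wk unfolding a_def by (intro bexI[of _ k]) auto
  qed
  with that show thesis by blast
qed

text \<open>Cannon's argument: a minimal path to a geodesic continuation of \<open>a\<close> passes within \<open>M\<close> of
  \<open>a\<close>, so the increments of the norm along continuations depend only on its values near \<open>a\<close>.\<close>

definition profile :: "nat \<Rightarrow> 'a \<Rightarrow> 'a \<Rightarrow> int" where
  "profile M a k = (if k \<in> carrier G \<and> len k \<le> M then int (nrm (a \<otimes> k)) - int (nrm a) else 0)"

text \<open>The Lipschitz bound confines the values to finitely many integers on a finite ball, and
  the default 0 fixes the function elsewhere.\<close>

lemma finite_profiles: "finite (profile M ` carrier G)"
proof -
  have "profile M ` carrier G \<subseteq>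
      {f. \<forall>k. (k \<in> {a \<in> carrier G. len a \<le> M} \<longrightarrow> f k \<in> {- int M..int M}) \<and>
              (k \<notin> {a \<in> carrier G. len a \<le> M} \<longrightarrow> f k = 0)}"
  proof safe
    fix a k assume a: "a \<in> carrier G" and k: "k \<in> carrier G" "len k \<le> M"
    then have "\<bar>profile M a k\<bar> \<le> int M"
      using norm_right_lipschitz[of a k] by (simp add: profile_def)
    then show "profile M a k \<in> {- int M..int M}" by auto
  qed (auto simp: profile_def split: if_splits)
  then show ?thesis
    using finite_set_of_finite_funs[OF finite_ball finite_atLeastAtMost_int] by (rule finite_subset)
qed

text \<open>The element \<open>k\<close> at which a minimal path splits near \<open>w'\<close> is
  transported to \<open>w\<close>, where it gives a competitor with the same increment. Since
  geodesicity is asked of \<open>w' @ u\<close>, equality comes from exchanging \<open>w\<close> and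
  \<open>w'\<close>, and the one-sided form can itself be used to prove that a word is
  geodesic.\<close>

lemma norm_increment_le:
  assumes M: "\<And>w u t. set w \<subseteq> S \<Longrightarrow> set u \<subseteq> S \<Longrightarrow> set t \<subseteq> S \<Longrightarrow> length t \<le> 1 \<Longrightarrow>
    len (val (w @ u)) = length (w @ u) \<Longrightarrow>
    \<exists>k\<in>carrier G. len k \<le> M \<and>
      nrm (val (w @ u @ t)) = nrm (val w \<otimes> k) + nrm (inv k \<otimes> val (u @ t))"
    and S: "set w \<subseteq> S" "set w' \<subseteq> S" "set u \<subseteq> S" "set t \<subseteq> S" "length t \<le> 1"
    and g: "len (val (w' @ u)) = length (w' @ u)"
    and p: "profile M (val w) = profile M (val w')"
  shows "int (nrm (val (w @ u @ t))) - int (nrm (val w))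
    \<le> int (nrm (val (w' @ u @ t))) - int (nrm (val w'))"
proof -
  obtain k where k: "k \<in> carrier G" "len k \<le> M"
    "nrm (val (w' @ u @ t)) = nrm (val w' \<otimes> k) + nrm (inv k \<otimes> val (u @ t))"
    using M[OF S(2-5) g] by blast
  have cl: "val w \<in> carrier G" "val (u @ t) \<in> carrier G" using S by auto
  have "val (w @ u @ t) = val w \<otimes> val (u @ t)" using S val_append[of w "u @ t"] by simp
  also have "\<dots> = (val w \<otimes> k) \<otimes> (inv k \<otimes> val (u @ t))"
    using cl k(1) by (simp add: m_assoc mult_inv_cancel)
  finally have "nrm (val (w @ u @ t)) \<le> nrm (val w \<otimes> k) + nrm (inv k \<otimes> val (u @ t))"
    using norm_mult[of "val w \<otimes> k" "inv k \<otimes> val (u @ t)"] cl k(1) by simp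
  moreover have "int (nrm (val w \<otimes> k)) - int (nrm (val w)) = int (nrm (val w' \<otimes> k)) - int (nrm (val w'))"
    using fun_cong[OF p, of k] k by (simp add: profile_def)
  ultimately show ?thesis using k(3) by linarith
qed

end

subsection \<open>Myhill--Nerode construction of digraphs\<close>

text \<open>A Myhill--Nerode construction: the state reached by \<open>w\<close> records, for every continuation
  \<open>u\<close> inside the language, the increment of \<open>\<phi>\<close> along \<open>u\<close>. The last increment is added to
  the state because the vertex weights have to be read off at the head of an edge.\<close>

definition residual :: "'a list set \<Rightarrow> ('a list \<Rightarrow> int) \<Rightarrow> 'a list \<Rightarrow> 'a list \<Rightarrow> int option" where
  "residual L \<phi> w u = (if w @ u \<in> L then Some (\<phi> (w @ u) - \<phi> w) else None)"

text \<open>The value \<open>\<phi> []\<close> at the empty word becomes the weight of the initial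
  vertex, so that the sum over all visited vertices telescopes to \<open>\<phi> w\<close>
  itself.\<close>

definition last_increment :: "('a list \<Rightarrow> int) \<Rightarrow> 'a list \<Rightarrow> int" where
  "last_increment \<phi> w = (if w = [] then \<phi> [] else \<phi> w - \<phi> (butlast w))"

lemma sum_last_increment: "(\<Sum>i=0..length w. last_increment \<phi> (take i w)) = \<phi> w"
proof (induction w rule: rev_induct)
  case Nil
  then show ?case by (simp add: last_increment_def)
next
  case (snoc s w)
  have "(\<Sum>i=0..length (w @ [s]). last_increment \<phi> (take i (w @ [s]))) =
      (\<Sum>i=0..length w. last_increment \<phi> (take i (w @ [s]))) + last_increment \<phi> (w @ [s])"
    by simp
  also have "(\<Sum>i=0..length w. last_increment \<phi> (take i (w @ [s]))) = \<phi> w"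
  proof -
    have "(\<Sum>i=0..length w. last_increment \<phi> (take i (w @ [s]))) =
        (\<Sum>i=0..length w. last_increment \<phi> (take i w))"
      by (rule sum.cong) auto
    with snoc.IH show ?thesis by simp
  qed
  finally show ?case by (simp add: last_increment_def)
qed

text \<open>Makes the transitions of the digraph well defined. The residual at \<open>[s]\<close>
  gives membership and the new increment; the residual at \<open>s # u\<close> gives the new
  residual at \<open>u\<close>.\<close>

lemma residual_step:
  assumes "residual L \<phi> w = residual L \<phi> w'" "w @ [s] \<in> L"
  shows "w' @ [s] \<in> L" "residual L \<phi> (w @ [s]) = residual L \<phi> (w' @ [s])"
    "last_increment \<phi> (w @ [s]) = last_increment \<phi> (w' @ [s])"
proof -
  have s: "residual L \<phi> w [s] = residual L \<phi> w' [s]" using assms by simp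
  then show w': "w' @ [s] \<in> L" using assms(2) by (auto simp: residual_def split: if_splits)
  have inc: "\<phi> (w @ [s]) - \<phi> w = \<phi> (w' @ [s]) - \<phi> w'"
    using s w' assms(2) by (simp add: residual_def)
  then show "last_increment \<phi> (w @ [s]) = last_increment \<phi> (w' @ [s])"
    by (simp add: last_increment_def)
  show "residual L \<phi> (w @ [s]) = residual L \<phi> (w' @ [s])"
  proof
    fix u
    have "residual L \<phi> w (s # u) = residual L \<phi> w' (s # u)" using assms by simp
    then show "residual L \<phi> (w @ [s]) u = residual L \<phi> (w' @ [s]) u"
      using inc by (auto simp: residual_def split: if_splits)
  qed
qed

lemma prefix_closed_appendD: "prefix_closed L \<Longrightarrow> u @ v \<in> L \<Longrightarrow> u \<in> L"
  unfolding prefix_closed_def by (meson prefixI)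

theorem myhill_nerode_weights:
  fixes L :: "'a list set" and \<phi> :: "'a list \<Rightarrow> int"
  assumes S: "finite S" "L \<subseteq> lists S" and L: "prefix_closed L" "[] \<in> L"
    and fin: "finite (residual L \<phi> ` L)"
  obtains \<Gamma> v\<^sub>1 lab d\<phi> where "parameterizes \<Gamma> v\<^sub>1 lab S L"
    "\<And>p v. pre_digraph.awalk \<Gamma> v\<^sub>1 p v \<Longrightarrow>
       \<phi> (map lab p) = (\<Sum>i=0..length p. d\<phi> (pre_digraph.awalk_verts \<Gamma> v\<^sub>1 p ! i))"
proof -
  define \<kappa> where "\<kappa> w = (residual L \<phi> w, last_increment \<phi> w)" for w
  define Q where "Q = \<kappa> ` L"
  define E where "E = {(\<kappa> w, s, \<kappa> (w @ [s])) | w s. w @ [s] \<in> L}"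
  have inL: "w \<in> L" "s \<in> S" if "w @ [s] \<in> L" for w s
    using that S L(1) prefix_closed_appendD by auto
  have step: "w' @ [s] \<in> L \<and> \<kappa> (w @ [s]) = \<kappa> (w' @ [s])"
    if "\<kappa> w = \<kappa> w'" "w @ [s] \<in> L" for w w' s
    using residual_step[of L \<phi> w w' s] that by (auto simp: \<kappa>_def)
  \<comment> \<open>The last increment of \<open>w' @ [s]\<close> can be read off the residual of
    \<open>w'\<close> at \<open>[s]\<close>, so it ranges over a set indexed by residuals and
    letters. The empty word is listed separately, having no last letter.\<close>
  have "Q \<subseteq> insert (\<kappa> []) (residual L \<phi> ` L \<times> (\<lambda>(F, s). the (F [s])) ` (residual L \<phi> ` L \<times> S))"
  proof
    fix q assume "q \<in> Q"
    then obtain w where w: "q = \<kappa> w" "w \<in> L" by (auto simp: Q_def)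
    show "q \<in> insert (\<kappa> []) (residual L \<phi> ` L \<times> (\<lambda>(F, s). the (F [s])) ` (residual L \<phi> ` L \<times> S))"
    proof (cases w rule: rev_cases)
      case (snoc w' s)
      have "last_increment \<phi> w = the (residual L \<phi> w' [s])"
        using snoc w by (simp add: last_increment_def residual_def)
      then have "last_increment \<phi> w \<in> (\<lambda>(F, s). the (F [s])) ` (residual L \<phi> ` L \<times> S)"
        using inL[of w' s] snoc w by (intro image_eqI[of _ _ "(residual L \<phi> w', s)"]) auto
      then show ?thesis using w by (auto simp: \<kappa>_def)
    qed (use w in simp)
  qed
  then have finQ: "finite Q" by (rule finite_subset) (use fin S(1) in auto)
  have "E \<subseteq> Q \<times> S \<times> Q" using inL by (auto simp: E_def Q_def)
  then have finE: "finite E" by (rule finite_subset) (use finQ S(1) in auto)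
  obtain ev :: "_ \<Rightarrow> nat" where ev: "inj_on ev Q" using finite_imp_inj_to_nat_seg[OF finQ] by blast
  obtain ee :: "_ \<Rightarrow> nat" where ee: "inj_on ee E" using finite_imp_inj_to_nat_seg[OF finE] by blast
  define dec where "dec = inv_into E ee"
  define lab where "lab e = fst (snd (dec e))" for e
  define \<Gamma> where "\<Gamma> = \<lparr>verts = ev ` Q, arcs = ee ` E,
      tail = (\<lambda>e. ev (fst (dec e))), head = (\<lambda>e. ev (snd (snd (dec e))))\<rparr>"
  define d\<phi> where "d\<phi> n = snd (inv_into Q ev n)" for n
  have dec: "dec (ee x) = x" if "x \<in> E" for x
    using ee that by (simp add: dec_def)
  have decE: "dec e \<in> E" if "e \<in> arcs \<Gamma>" for e using that dec by (auto simp: \<Gamma>_def)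
  have \<kappa>Q: "\<kappa> w \<in> Q" if "w \<in> L" for w using that by (auto simp: Q_def)
  have fd: "fin_digraph \<Gamma>"
  proof
    fix e assume "e \<in> arcs \<Gamma>"
    then have "dec e \<in> Q \<times> S \<times> Q" using decE \<open>E \<subseteq> Q \<times> S \<times> Q\<close> by blast
    then show "tail \<Gamma> e \<in> verts \<Gamma>" "head \<Gamma> e \<in> verts \<Gamma>" by (auto simp: \<Gamma>_def)
  qed (use finQ finE in \<open>auto simp: \<Gamma>_def\<close>)
  have labS: "\<forall>e\<in>arcs \<Gamma>. lab e \<in> S"
    using decE \<open>E \<subseteq> Q \<times> S \<times> Q\<close> by (fastforce simp: lab_def)
  have arc: "\<exists>w. w @ [lab e] \<in> L \<and> tail \<Gamma> e = ev (\<kappa> w) \<and> head \<Gamma> e = ev (\<kappa> (w @ [lab e])) \<and>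
      dec e = (\<kappa> w, lab e, \<kappa> (w @ [lab e]))"
    if "e \<in> arcs \<Gamma>" for e
    using decE[OF that] by (auto simp: E_def lab_def \<Gamma>_def)
  have \<kappa>eq: "\<kappa> w = \<kappa> w'" if "ev (\<kappa> w) = ev (\<kappa> w')" "w \<in> L" "w' \<in> L" for w w'
    using inj_onD[OF ev that(1)] \<kappa>Q that by blast
  have det: "e = f" if ef: "e \<in> arcs \<Gamma>" "f \<in> arcs \<Gamma>" "tail \<Gamma> e = tail \<Gamma> f" "lab e = lab f" for e f
  proof -
    obtain w where w: "w @ [lab e] \<in> L" "tail \<Gamma> e = ev (\<kappa> w)" "dec e = (\<kappa> w, lab e, \<kappa> (w @ [lab e]))"
      using arc[OF ef(1)] by blast
    obtain w' where w': "w' @ [lab f] \<in> L" "tail \<Gamma> f = ev (\<kappa> w')" "dec f = (\<kappa> w', lab f, \<kappa> (w' @ [lab f]))"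
      using arc[OF ef(2)] by blast
    have "\<kappa> w = \<kappa> w'" using \<kappa>eq[of w w'] inL(1)[OF w(1)] inL(1)[OF w'(1)] w(2) w'(2) ef(3) by simp
    then have "dec e = dec f" using step[of w w' "lab e"] w(1,3) w'(3) ef(4) by simp
    then show ?thesis using ef(1,2) dec by (auto simp: \<Gamma>_def)
  qed
  \<comment> \<open>Stated from an arbitrary \<open>w\<close> because the induction consumes arcs at
    the front. An arc may stem from a word other than the one read so far; both have the same state,
    and \<open>step\<close> moves the arc over.\<close>
  have walk: "w @ map lab p \<in> L \<and> (\<forall>i\<le>length p. pre_digraph.awalk_verts \<Gamma> (ev (\<kappa> w)) p ! i =
      ev (\<kappa> (w @ take i (map lab p))))"
    if "w \<in> L" "pre_digraph.awalk \<Gamma> (ev (\<kappa> w)) p v" for w p v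
    using that
  proof (induction p arbitrary: w)
    case Nil
    then show ?case by (simp add: pre_digraph.awalk_verts.simps)
  next
    case (Cons e p)
    have e: "e \<in> arcs \<Gamma>" "tail \<Gamma> e = ev (\<kappa> w)" and p: "pre_digraph.awalk \<Gamma> (head \<Gamma> e) p v"
      using Cons.prems fin_digraph.axioms(1)[OF fd]
      by (auto simp: pre_digraph.awalk_def pre_digraph.cas.simps wf_digraph_def)
    obtain w' where w': "w' @ [lab e] \<in> L" "tail \<Gamma> e = ev (\<kappa> w')" "head \<Gamma> e = ev (\<kappa> (w' @ [lab e]))"
      using arc[OF e(1)] by blast
    have "\<kappa> w' = \<kappa> w" using \<kappa>eq[of w' w] inL(1)[OF w'(1)] w'(2) Cons.prems(1) e(2) by simp
    then have st: "w @ [lab e] \<in> L" "head \<Gamma> e = ev (\<kappa> (w @ [lab e]))" using step[OF _ w'(1)] w'(3) by auto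
    note IH = Cons.IH[OF st(1) p[unfolded st(2)]]
    have "pre_digraph.awalk_verts \<Gamma> (ev (\<kappa> w)) (e # p) ! i = ev (\<kappa> (w @ take i (map lab (e # p))))"
      if "i \<le> length (e # p)" for i
      using that IH e st(2) by (cases i) (auto simp: pre_digraph.awalk_verts.simps)
    with IH show ?case by simp
  qed
  have walk_ex: "\<exists>p v. pre_digraph.awalk \<Gamma> (ev (\<kappa> w)) p v \<and> map lab p = u"
    if "w @ u \<in> L" for w u
    using that
  proof (induction u arbitrary: w)
    case Nil
    then show ?case
      by (intro exI[of _ "[]"] exI[of _ "ev (\<kappa> w)"])
        (auto simp: pre_digraph.awalk_def pre_digraph.cas.simps \<Gamma>_def \<kappa>Q)
  next
    case (Cons s u)
    then have ws: "w @ [s] \<in> L" using prefix_closed_appendD[OF L(1), of "w @ [s]" u] by simp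
    obtain p v where p: "pre_digraph.awalk \<Gamma> (ev (\<kappa> (w @ [s]))) p v" "map lab p = u"
      using Cons.IH[of "w @ [s]"] Cons.prems by auto
    define x where "x = (\<kappa> w, s, \<kappa> (w @ [s]))"
    have x: "x \<in> E" using ws by (auto simp: E_def x_def)
    have "pre_digraph.awalk \<Gamma> (ev (\<kappa> w)) (ee x # p) v"
      using p(1) dec[OF x] x inL(1)[OF ws] \<kappa>Q
      by (auto simp: pre_digraph.awalk_def pre_digraph.cas.simps \<Gamma>_def) (simp_all add: x_def)
    moreover have "map lab (ee x # p) = s # u" using p(2) dec[OF x] by (simp add: lab_def x_def)
    ultimately show ?case by (intro exI conjI)
  qed
  have "L = {map lab p | p v. pre_digraph.awalk \<Gamma> (ev (\<kappa> [])) p v}"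
  proof
    show "L \<subseteq> {map lab p | p v. pre_digraph.awalk \<Gamma> (ev (\<kappa> [])) p v}"
      using walk_ex[of "[]"] by fastforce
    show "{map lab p | p v. pre_digraph.awalk \<Gamma> (ev (\<kappa> [])) p v} \<subseteq> L"
      using walk[OF L(2)] by auto
  qed
  then have par: "parameterizes \<Gamma> (ev (\<kappa> [])) lab S L"
    unfolding parameterizes_def using fd labS det \<kappa>Q[OF L(2)] by (auto simp: \<Gamma>_def)
  moreover have "\<phi> (map lab p) = (\<Sum>i=0..length p. d\<phi> (pre_digraph.awalk_verts \<Gamma> (ev (\<kappa> [])) p ! i))"
    if p: "pre_digraph.awalk \<Gamma> (ev (\<kappa> [])) p v" for p v
  proof -
    have "d\<phi> (pre_digraph.awalk_verts \<Gamma> (ev (\<kappa> [])) p ! i) = last_increment \<phi> (take i (map lab p))"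
      if i: "i \<le> length p" for i
    proof -
      have "take i (map lab p) @ drop i (map lab p) \<in> L" using walk[OF L(2) p] by simp
      then have "take i (map lab p) \<in> L" by (rule prefix_closed_appendD[OF L(1)])
      then have "inv_into Q ev (ev (\<kappa> (take i (map lab p)))) = \<kappa> (take i (map lab p))"
        using ev \<kappa>Q by simp
      then show ?thesis using walk[OF L(2) p] i by (simp add: d\<phi>_def \<kappa>_def)
    qed
    then have "(\<Sum>i=0..length p. d\<phi> (pre_digraph.awalk_verts \<Gamma> (ev (\<kappa> [])) p ! i)) =
        (\<Sum>i=0..length (map lab p). last_increment \<phi> (take i (map lab p)))"
      by (intro sum.cong) auto
    then show ?thesis using sum_last_increment[of \<phi> "map lab p"] by simp
  qed
  ultimately show thesis using that by blast
qed

subsection \<open>Combability of weighted norms and existence of combings\<close>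

lemma finite_image_factor:
  assumes "finite (g ` A)" and "\<And>x y. x \<in> A \<Longrightarrow> y \<in> A \<Longrightarrow> g x = g y \<Longrightarrow> f x = f y"
  shows "finite (f ` A)"
proof -
  have "f ` A \<subseteq> (\<lambda>z. f (inv_into A g z)) ` (g ` A)"
  proof
    fix b assume "b \<in> f ` A"
    then obtain a where a: "a \<in> A" "b = f a" by blast
    have "f (inv_into A g (g a)) = f a"
      using a(1) by (intro assms(2)) (auto simp: inv_into_into f_inv_into_f)
    then show "b \<in> (\<lambda>z. f (inv_into A g z)) ` (g ` A)"
      using a by (intro image_eqI[of _ _ "g a"]) auto
  qed
  then show ?thesis using assms(1) finite_surj by blast
qed

lemma lex_append_eq_length:
  "length x = length y \<Longrightarrow> (x @ u, y @ v) \<in> lex r \<Longrightarrow> length u = length v \<Longrightarrow>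
    (x, y) \<in> lex r \<or> x = y \<and> (u, v) \<in> lex r"
  by (induction x y rule: list_induct2) auto

context word_group
begin

lemma combing_Nil: "combing G S L \<Longrightarrow> [] \<in> L"
proof -
  assume L: "combing G S L"
  then have "\<one> \<in> word_eval G ` L" unfolding combing_def bij_betw_def by auto
  then obtain w where "w \<in> L" by blast
  then show "[] \<in> L" using L unfolding combing_def prefix_closed_def by (meson Nil_prefix)
qed

lemma combing_geodesic:
  assumes "combing G S L" "w \<in> L"
  shows "set w \<subseteq> S" "len (val w) = length w"
  using assms unfolding combing_def by auto

text \<open>The state is the set of all vertices reached by reading \<open>w\<close>, which is
  defined for every word and empty outside \<open>L\<close>. A path for \<open>u\<close> from a
  common vertex can be attached to a path for \<open>w'\<close>.\<close>

lemma combing_step_finite: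
  assumes L: "combing G S L"
  obtains st :: "'a list \<Rightarrow> nat set" where "finite (st ` L)"
    "\<And>w w' u. st w = st w' \<Longrightarrow> w @ u \<in> L \<Longrightarrow> w' @ u \<in> L"
proof -
  obtain \<Gamma> v\<^sub>1 lab where par: "parameterizes \<Gamma> v\<^sub>1 lab S L" using L unfolding combing_def by blast
  interpret \<Gamma>: fin_digraph \<Gamma> using par unfolding parameterizes_def by blast
  have Leq: "L = {map lab p | p v. \<Gamma>.awalk v\<^sub>1 p v}" using par unfolding parameterizes_def by blast
  define st where "st w = {v. \<exists>p. \<Gamma>.awalk v\<^sub>1 p v \<and> map lab p = w}" for w
  have "st ` L \<subseteq> Pow (verts \<Gamma>)" by (auto simp: st_def \<Gamma>.awalk_last_in_verts)
  then have "finite (st ` L)" by (rule finite_subset) simp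
  moreover have "w' @ u \<in> L" if e: "st w = st w'" and w: "w @ u \<in> L" for w w' u
  proof -
    obtain p v where p: "\<Gamma>.awalk v\<^sub>1 p v" "map lab p = w @ u" using w Leq by auto
    obtain p1 p2 where p12: "p = p1 @ p2" "map lab p1 = w" "map lab p2 = u"
      using p(2) by (auto simp: map_eq_append_conv)
    define b where "b = \<Gamma>.awlast v\<^sub>1 p1"
    have b: "\<Gamma>.awalk v\<^sub>1 p1 b" "\<Gamma>.awalk b p2 v" using p(1) p12(1) by (auto simp: b_def)
    then have "b \<in> st w'" using e p12(2) by (auto simp: st_def)
    then obtain q where q: "\<Gamma>.awalk v\<^sub>1 q b" "map lab q = w'" by (auto simp: st_def)
    have "\<Gamma>.awalk v\<^sub>1 (q @ p2) v" using \<Gamma>.awalk_appendI[OF q(1) b(2)] .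
    moreover have "map lab (q @ p2) = w' @ u" using q p12 by simp
    ultimately show ?thesis unfolding Leq by (metis (mono_tags, lifting) mem_Collect_eq)
  qed
  ultimately show thesis using that by blast
qed

lemma norm_difference_weakly_combable:
  assumes hyp: "word_hyperbolic G" and L: "combing G S L"
    and W1: "weighted_word_group G S W1 K1" and W2: "weighted_word_group G S W2 K2"
    and \<phi>: "\<And>a. a \<in> carrier G \<Longrightarrow> \<phi> a = int (weighted_norm G W1 a) - int (weighted_norm G W2 a)"
  shows "weakly_combable G S L \<phi>"
proof -
  interpret A: weighted_word_group G S W1 K1 by (rule W1)
  interpret B: weighted_word_group G S W2 K2 by (rule W2)
  obtain M1 where M1: "\<And>w u t. set w \<subseteq> S \<Longrightarrow> set u \<subseteq> S \<Longrightarrow> set t \<subseteq> S \<Longrightarrow> length t \<le> 1 \<Longrightarrow>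
    len (val (w @ u)) = length (w @ u) \<Longrightarrow>
    \<exists>k\<in>carrier G. len k \<le> M1 \<and>
      A.nrm (val (w @ u @ t)) = A.nrm (val w \<otimes> k) + A.nrm (inv k \<otimes> val (u @ t))"
    using A.norm_splits_near_geodesic[OF hyp] by blast
  obtain M2 where M2: "\<And>w u t. set w \<subseteq> S \<Longrightarrow> set u \<subseteq> S \<Longrightarrow> set t \<subseteq> S \<Longrightarrow> length t \<le> 1 \<Longrightarrow>
    len (val (w @ u)) = length (w @ u) \<Longrightarrow>
    \<exists>k\<in>carrier G. len k \<le> M2 \<and>
      B.nrm (val (w @ u @ t)) = B.nrm (val w \<otimes> k) + B.nrm (inv k \<otimes> val (u @ t))"
    using B.norm_splits_near_geodesic[OF hyp] by blast
  obtain st :: "'a list \<Rightarrow> nat set" where st: "finite (st ` L)"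
    "\<And>w w' u. st w = st w' \<Longrightarrow> w @ u \<in> L \<Longrightarrow> w' @ u \<in> L"
    using combing_step_finite[OF L] by blast
  \<comment> \<open>One state for both norms, so that the difference is realised on a single
    digraph.\<close>
  define g where "g w = (st w, A.profile M1 (val w), B.profile M2 (val w))" for w
  have vc: "val w \<in> carrier G" if "w \<in> L" for w using combing_geodesic[OF L that] by auto
  have "g ` L \<subseteq> st ` L \<times> A.profile M1 ` carrier G \<times> B.profile M2 ` carrier G"
    using vc by (auto simp: g_def)
  then have fin_g: "finite (g ` L)"
    by (rule finite_subset) (intro finite_cartesian_product st(1) A.finite_profiles B.finite_profiles)
  define \<psi> where "\<psi> w = \<phi> (val w)" for w
  have inc: "\<psi> (w @ u) - \<psi> w = \<psi> (w' @ u) - \<psi> w'"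
    if w: "w \<in> L" "w' \<in> L" "g w = g w'" "w @ u \<in> L" "w' @ u \<in> L" for w w' u
  proof -
    note geo = combing_geodesic[OF L]
    have S: "set w \<subseteq> S" "set w' \<subseteq> S" "set u \<subseteq> S" using geo(1)[OF w(1)] geo(1)[OF w(2)] geo(1)[OF w(4)] by auto
    have p: "A.profile M1 (val w) = A.profile M1 (val w')" "B.profile M2 (val w) = B.profile M2 (val w')"
      using w(3) by (auto simp: g_def)
    have "int (A.nrm (val (w @ u))) - int (A.nrm (val w)) = int (A.nrm (val (w' @ u))) - int (A.nrm (val w'))"
      using A.norm_increment_le[OF M1 S(1,2,3), of "[]"] A.norm_increment_le[OF M1 S(2,1,3), of "[]"]
        geo(2)[OF w(4)] geo(2)[OF w(5)] p(1) by fastforce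
    moreover have "int (B.nrm (val (w @ u))) - int (B.nrm (val w)) = int (B.nrm (val (w' @ u))) - int (B.nrm (val w'))"
      using B.norm_increment_le[OF M2 S(1,2,3), of "[]"] B.norm_increment_le[OF M2 S(2,1,3), of "[]"]
        geo(2)[OF w(4)] geo(2)[OF w(5)] p(2) by fastforce
    ultimately show ?thesis unfolding \<psi>_def using vc w \<phi> by simp
  qed
  have "residual L \<psi> w = residual L \<psi> w'" if w: "w \<in> L" "w' \<in> L" "g w = g w'" for w w'
  proof
    fix u
    have "w @ u \<in> L \<longleftrightarrow> w' @ u \<in> L" using st(2)[of w w' u] st(2)[of w' w u] w(3) by (auto simp: g_def)
    then show "residual L \<psi> w u = residual L \<psi> w' u"
      using inc[OF w, of u] by (simp add: residual_def)
  qed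
  then have "finite (residual L \<psi> ` L)" by (rule finite_image_factor[OF fin_g])
  moreover have "L \<subseteq> lists S" "prefix_closed L" using L by (auto simp: combing_def)
  ultimately obtain \<Gamma> v\<^sub>1 lab d\<phi> where "parameterizes \<Gamma> v\<^sub>1 lab S L"
    "\<And>p v. pre_digraph.awalk \<Gamma> v\<^sub>1 p v \<Longrightarrow>
       \<psi> (map lab p) = (\<Sum>i=0..length p. d\<phi> (pre_digraph.awalk_verts \<Gamma> v\<^sub>1 p ! i))"
    using myhill_nerode_weights[OF S_finite _ _ combing_Nil[OF L], of \<psi>] by blast
  then show ?thesis unfolding weakly_combable_def \<psi>_def
    by (intro exI[of _ \<Gamma>] exI[of _ v\<^sub>1] exI[of _ lab] exI[of _ d\<phi>]) auto
qed

lemma norm_difference_bicombable: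
  assumes hyp: "word_hyperbolic G" and L: "combing G S L"
    and W1: "weighted_word_group G S W1 K1" and W2: "weighted_word_group G S W2 K2"
    and \<phi>: "\<And>a. a \<in> carrier G \<Longrightarrow> \<phi> a = int (weighted_norm G W1 a) - int (weighted_norm G W2 a)"
  shows "bicombable G S L \<phi>"
  unfolding bicombable_def
\<comment> \<open>Multiplication by a generator on either side changes each of the two norms by at
  most 1.\<close>
proof (intro conjI exI[of _ 2] ballI)
  interpret A: weighted_word_group G S W1 K1 by (rule W1)
  interpret B: weighted_word_group G S W2 K2 by (rule W2)
  show "weakly_combable G S L \<phi>" by (rule norm_difference_weakly_combable[OF assms])
  fix a s assume a: "a \<in> carrier G" and s: "s \<in> S"
  have sc: "s \<in> carrier G" "len s \<le> 1" using s S_carrier len_gen by auto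
  show "\<bar>\<phi> (a \<otimes> s) - \<phi> a\<bar> \<le> 2"
    using A.norm_right_lipschitz[OF a sc(1)] B.norm_right_lipschitz[OF a sc(1)] sc(2) \<phi> a sc(1) by simp
  show "\<bar>\<phi> (s \<otimes> a) - \<phi> a\<bar> \<le> 2"
    using A.norm_left_lipschitz[OF a sc(1)] B.norm_left_lipschitz[OF a sc(1)] sc(2) \<phi> a sc(1) by simp
qed

lemma unit_weights: "weighted_word_group G S (S \<times> {1}) 1"
  by unfold_locales (use S_carrier len_gen in auto)

section \<open>Shortlex geodesics form a combing\<close>

definition shortlex :: "('a \<times> 'a) set \<Rightarrow> 'a list set" where
  "shortlex r = {w. set w \<subseteq> S \<and> (\<forall>x. set x \<subseteq> S \<longrightarrow> val x = val w \<longrightarrow> (x, w) \<notin> lenlex r)}"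

lemma shortlex_geodesic:
  assumes "w \<in> shortlex r"
  shows "set w \<subseteq> S" "len (val w) = length w"
proof -
  show S: "set w \<subseteq> S" using assms by (simp add: shortlex_def)
  obtain x where "set x \<subseteq> S" "length x = len (val w)" "val x = val w"
    using len_word[OF val_closed[OF S]] by metis
  then show "len (val w) = length w"
    using assms len_le[OF S] unfolding shortlex_def lenlex_conv by fastforce
qed

lemma shortlex_prefix: assumes "u @ v \<in> shortlex r" shows "u \<in> shortlex r"
proof -
  have S: "set u \<subseteq> S" "set v \<subseteq> S" using shortlex_geodesic[OF assms] by auto
  have False if x: "set x \<subseteq> S" "val x = val u" "(x, u) \<in> lenlex r" for x
  proof -
    have "(x @ v, u @ v) \<in> lenlex r" using lenlex_append1[OF x(3)] by simp
    moreover have "val (x @ v) = val (u @ v)" using x S by (simp add: val_append)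
    ultimately show False using assms x S unfolding shortlex_def by auto
  qed
  then show ?thesis using S unfolding shortlex_def by blast
qed

text \<open>Equal profiles give equal cone types. Letter by letter, \<open>w' @ u\<close> is already
  geodesic, and the increment inequality with the new letter as \<open>t\<close> forces the length
  to grow along \<open>w'\<close> as much as along \<open>w\<close>.\<close>

lemma geodesic_continuation_transfer:
  assumes M: "\<And>w u t. set w \<subseteq> S \<Longrightarrow> set u \<subseteq> S \<Longrightarrow> set t \<subseteq> S \<Longrightarrow> length t \<le> 1 \<Longrightarrow>
    len (val (w @ u)) = length (w @ u) \<Longrightarrow>
    \<exists>k\<in>carrier G. len k \<le> M \<and>
      len (val (w @ u @ t)) = len (val w \<otimes> k) + len (inv k \<otimes> val (u @ t))"
    and S: "set w \<subseteq> S" "set w' \<subseteq> S"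
    and p: "weighted_word_group.profile G S (S \<times> {1}) M (val w) =
      weighted_word_group.profile G S (S \<times> {1}) M (val w')"
    and g: "len (val w') = length w'"
  shows "set u \<subseteq> S \<Longrightarrow> len (val (w @ u)) = length (w @ u) \<Longrightarrow> len (val (w' @ u)) = length (w' @ u)"
proof (induction u rule: rev_induct)
  case Nil
  then show ?case using g by simp
next
  case (snoc s u)
  interpret U: weighted_word_group G S "S \<times> {1}" 1 by (rule unit_weights)
  note W = weighted_norm_unit_weights[of G S]
  have su: "set u \<subseteq> S" "set [s] \<subseteq> S" using snoc.prems by auto
  have wu: "len (val (w @ u)) = length (w @ u)"
    using geodesic_split(1)[of "w @ u" "[s]"] snoc.prems S by auto
  have lw: "len (val w) = length w" using geodesic_split(1)[of w u] wu S su by auto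
  have "int (len (val (w @ u @ [s]))) - int (len (val w))
      \<le> int (len (val (w' @ u @ [s]))) - int (len (val w'))"
    using U.norm_increment_le[unfolded W, OF M S su _ snoc.IH[OF su(1) wu] p] by simp
  then have "length (w' @ u @ [s]) \<le> len (val (w' @ u @ [s]))"
    using snoc.prems(2) lw g by simp
  moreover have "len (val (w' @ u @ [s])) \<le> length (w' @ u @ [s])"
    by (rule len_le) (use S su in auto)
  ultimately show ?case by simp
qed

theorem hyperbolic_ex_combing:
  assumes hyp: "word_hyperbolic G"
  shows "\<exists>L. combing G S L"
proof -
  interpret U: weighted_word_group G S "S \<times> {1}" 1 by (rule unit_weights)
  note W = weighted_norm_unit_weights[of G S]
  \<comment> \<open>An arbitrary well-order of the type: wellfoundedness provides normal forms,
    totality makes them unique.\<close>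
  obtain r0 :: "'a rel" where r0: "well_order_on UNIV r0" using well_order_on by blast
  define r where "r = r0 - Id"
  have wf: "wf r" using r0 by (simp add: r_def well_order_on_def)
  have total: "total r"
    using r0 unfolding r_def well_order_on_def linear_order_on_def total_on_def by auto
  define L where "L = shortlex r"
  obtain M where M: "\<And>w u t. set w \<subseteq> S \<Longrightarrow> set u \<subseteq> S \<Longrightarrow> set t \<subseteq> S \<Longrightarrow> length t \<le> 1 \<Longrightarrow>
    len (val (w @ u)) = length (w @ u) \<Longrightarrow>
    \<exists>k\<in>carrier G. len k \<le> M \<and>
      len (val (w @ u @ t)) = len (val w \<otimes> k) + len (inv k \<otimes> val (u @ t))"
    using U.norm_splits_near_geodesic[OF hyp, unfolded W] by blast
  obtain M' where M': "\<And>w u x v. set w \<subseteq> S \<Longrightarrow> set u \<subseteq> S \<Longrightarrow> set x \<subseteq> S \<Longrightarrow> set v \<subseteq> S \<Longrightarrow>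
    length x = length w \<Longrightarrow> val (w @ u) = val (x @ v) \<Longrightarrow>
    len (val (w @ u)) = length (w @ u) \<Longrightarrow> len (val (x @ v)) = length (x @ v) \<Longrightarrow>
    len (inv (val w) \<otimes> val x) \<le> M'"
    using geodesic_words_fellow_travel[OF hyp] by blast
  \<comment> \<open>Shortlex competitors of a continuation of \<open>w\<close> fellow-travel with it, so their prefixes of
    length \<open>length w\<close> evaluate into a ball around \<open>val w\<close>.\<close>
  define smaller where "smaller w = {k \<in> carrier G. len k \<le> M' \<and>
    (\<exists>x. set x \<subseteq> S \<and> length x = length w \<and> (x, w) \<in> lex r \<and> val x = val w \<otimes> k)}" for w
  define g where "g w = (U.profile M (val w), smaller w)" for w
  have "g ` L \<subseteq> U.profile M ` carrier G \<times> Pow {k \<in> carrier G. len k \<le> M'}"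
    using shortlex_geodesic(1) by (auto simp: g_def smaller_def L_def)
  then have fin_g: "finite (g ` L)"
    by (rule finite_subset) (intro finite_cartesian_product U.finite_profiles finite_Pow_iff[THEN iffD2] finite_ball)
  have transfer: "w' @ u \<in> L" if w: "w \<in> L" "w' \<in> L" "g w = g w'" "w @ u \<in> L" for w w' u
  proof -
    have S: "set w \<subseteq> S" "set w' \<subseteq> S" "set u \<subseteq> S"
      using shortlex_geodesic(1) w unfolding L_def by (metis Un_subset_iff set_append)+
    have geo: "len (val (w @ u)) = length (w @ u)" "len (val w') = length w'"
      using w shortlex_geodesic(2) unfolding L_def by auto
    have geo': "len (val (w' @ u)) = length (w' @ u)"
      using geodesic_continuation_transfer[OF M S(1,2) _ geo(2) S(3) geo(1)] w(3) by (simp add: g_def)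
    have no_smaller: False
      if y: "set y \<subseteq> S" "val y = val (w @ u)" "(y, w @ u) \<in> lex r" for y
    proof -
      have "(y, w @ u) \<in> lenlex r" using y(3) by (auto simp: lenlex_conv lex_conv)
      then show False using w(4) y unfolding L_def shortlex_def by blast
    qed
    have False if x: "set x \<subseteq> S" "val x = val (w' @ u)" "(x, w' @ u) \<in> lenlex r" for x
    proof -
      have lx: "length x = length (w' @ u)" "(x, w' @ u) \<in> lex r"
        using x(3) len_le[OF x(1)] x(2) geo' unfolding lenlex_conv by auto
      define x1 x2 where "x1 = take (length w') x" and "x2 = drop (length w') x"
      have x12: "x = x1 @ x2" "length x1 = length w'" "length x2 = length u"
        using lx(1) by (auto simp: x1_def x2_def)
      have Sx: "set x1 \<subseteq> S" "set x2 \<subseteq> S" using x(1) x12(1) by auto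
      have cl: "val x1 \<in> carrier G" "val x2 \<in> carrier G" "val w \<in> carrier G" "val w' \<in> carrier G"
          "val u \<in> carrier G"
        using Sx S by auto
      have vx: "val x1 \<otimes> val x2 = val w' \<otimes> val u"
        using x(2) x12(1) Sx S by (simp add: val_append)
      \<comment> \<open>If the competitor is smaller already within the first
        \<open>length w'\<close> letters, then equality of the sets \<open>smaller\<close> supplies
        a prefix \<open>y\<close> smaller than \<open>w\<close> with the same displacement, and
        \<open>y @ x2\<close> beats \<open>w @ u\<close>. Otherwise it agrees with \<open>w'\<close>
        there, and \<open>w @ x2\<close> beats \<open>w @ u\<close>.\<close>
      consider "(x1, w') \<in> lex r" | "x1 = w'" "(x2, u) \<in> lex r"
        using lex_append_eq_length[of x1 w' x2 u r] lx(2) x12 by auto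
      then show False
      proof cases
        case 1
        define k where "k = inv (val w') \<otimes> val x1"
        have kc: "k \<in> carrier G" and wk: "val w' \<otimes> k = val x1"
          using cl by (auto simp: k_def mult_inv_cancel)
        have "len k \<le> M'"
          unfolding k_def using M'[OF S(2,3) Sx x12(2)] x(2) x12(1) geo' lx(1) by simp
        then have "k \<in> smaller w'" unfolding smaller_def using kc wk 1 x12(2) Sx(1) by auto
        then have "k \<in> smaller w" using w(3) by (simp add: g_def)
        then obtain y where y: "set y \<subseteq> S" "length y = length w" "(y, w) \<in> lex r" "val y = val w \<otimes> k"
          by (auto simp: smaller_def)
        have "val w' \<otimes> (k \<otimes> val x2) = val w' \<otimes> val u"
          using vx wk cl kc by (simp add: m_assoc[symmetric])
        then have "k \<otimes> val x2 = val u" using cl kc by simp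
        then have "val (y @ x2) = val (w @ u)"
          using y S Sx cl kc by (simp add: val_append m_assoc)
        moreover have "(y @ x2, w @ u) \<in> lex r" using lex_append_rightI[OF y(3)] x12(3) by simp
        ultimately show False using no_smaller[of "y @ x2"] y(1) Sx(2) by simp
      next
        case 2
        then have "val x2 = val u" using vx cl by simp
        then have "val (w @ x2) = val (w @ u)" using S Sx by (simp add: val_append)
        moreover have "(w @ x2, w @ u) \<in> lex r" using lex_append_leftI[OF 2(2)] .
        ultimately show False using no_smaller[of "w @ x2"] S(1) Sx(2) by simp
      qed
    qed
    then show ?thesis using S unfolding L_def shortlex_def by auto
  qed
  \<comment> \<open>For the zero function the residual records membership only, so the construction
    yields the usual digraph of a regular language.\<close>
  have "residual L (\<lambda>_. 0) w = residual L (\<lambda>_. 0) w'" if w: "w \<in> L" "w' \<in> L" "g w = g w'" for w w'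
    using transfer[of w w'] transfer[of w' w] w by (auto simp: residual_def fun_eq_iff)
  then have fin: "finite (residual L (\<lambda>_. 0) ` L)" by (rule finite_image_factor[OF fin_g])
  have LS: "L \<subseteq> lists S" using shortlex_geodesic(1) by (auto simp: L_def)
  have pre: "prefix_closed L"
    unfolding prefix_closed_def L_def using shortlex_prefix by (metis prefix_def)
  have ex: "\<exists>w\<in>L. val w = a" if a: "a \<in> carrier G" for a
  proof -
    obtain w0 where w0: "w0 \<in> {w. set w \<subseteq> S \<and> val w = a}" using ex_word[OF a] by blast
    obtain w where w: "w \<in> {w. set w \<subseteq> S \<and> val w = a}"
      "\<And>y. (y, w) \<in> lenlex r \<Longrightarrow> y \<notin> {w. set w \<subseteq> S \<and> val w = a}"
      using wfE_min[OF wf_lenlex[OF wf] w0] by blast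
    then have "w \<in> L" by (auto simp: L_def shortlex_def)
    with w show ?thesis by auto
  qed
  have inj: "w = w'" if "w \<in> L" "w' \<in> L" "val w = val w'" for w w'
  proof (rule ccontr)
    assume "w \<noteq> w'"
    then have "(w, w') \<in> lenlex r \<or> (w', w) \<in> lenlex r"
      using total_lenlex[OF total] by (auto simp: total_on_def)
    then show False using that by (auto simp: L_def shortlex_def)
  qed
  have bij: "bij_betw (word_eval G) L (carrier G)"
    unfolding bij_betw_def
  proof
    show "inj_on (word_eval G) L" using inj by (intro inj_onI) auto
    show "word_eval G ` L = carrier G" using ex LS by fastforce
  qed
  obtain w where "w \<in> L" using ex[OF one_closed] by blast
  then have "[] \<in> L" using shortlex_prefix[of "[]" w r] by (simp add: L_def)
  then have "\<exists>\<Gamma> v\<^sub>1 lab. parameterizes \<Gamma> v\<^sub>1 lab S L"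
    by (rule myhill_nerode_weights[OF S_finite LS pre _ fin]) blast
  then have "combing G S L"
    unfolding combing_def using LS pre bij shortlex_geodesic(2) by (auto simp: L_def)
  then show ?thesis by blast
qed

end

subsection \<open>The counting function as a weighted norm\<close>

context word_group
begin

lemma reverse_path_of:
  "x \<in> carrier G \<Longrightarrow> set t \<subseteq> S \<Longrightarrow>
    reverse_path G (path_of x t) = path_of (x \<otimes> val t) (rev (map (m_inv G) t))"
proof (induction t arbitrary: x)
  case (Cons s t)
  have c: "s \<in> carrier G" "val t \<in> carrier G" using Cons.prems S_carrier by auto
  have "reverse_path G (path_of x (s # t)) =
      reverse_path G (path_of (x \<otimes> s) t) @ [(x \<otimes> s, inv s)]"
    by (simp add: reverse_path_def)
  also have "\<dots> = path_of (x \<otimes> s \<otimes> val t) (rev (map (m_inv G) t)) @ [(x \<otimes> s, inv s)]"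
    using Cons c by simp
  also have "\<dots> = path_of (x \<otimes> s \<otimes> val t) (rev (map (m_inv G) t) @ [inv s])"
  proof -
    have "x \<otimes> s \<otimes> val t \<otimes> inv (val t) = x \<otimes> s" using Cons.prems c by (simp add: m_assoc)
    moreover have "set (rev (map (m_inv G) t)) \<subseteq> carrier G"
      using rev_map_inv[of t] Cons.prems S_carrier by auto
    ultimately show ?thesis using Cons.prems c val_rev_map_inv[of t]
      by (subst path_of_append) auto
  qed
  finally show ?case using Cons.prems c by (simp add: m_assoc)
qed (simp add: reverse_path_def)

end

section \<open>Copies of a path as occurrences of its label\<close>

definition occurrences :: "'a list \<Rightarrow> 'a list \<Rightarrow> nat set" where
  "occurrences t w = {i. i + length t \<le> length w \<and> take (length t) (drop i w) = t}"

definition disjoint_occurrences :: "'a list \<Rightarrow> 'a list \<Rightarrow> nat set \<Rightarrow> bool" where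
  "disjoint_occurrences t w P \<longleftrightarrow>
     P \<subseteq> occurrences t w \<and> disjoint_family_on (\<lambda>i. {i..<i + length t}) P"

lemma finite_disjoint_occurrences: "disjoint_occurrences t w P \<Longrightarrow> finite P"
  by (rule finite_subset[of _ "{..length w}"])
    (auto simp: disjoint_occurrences_def occurrences_def)

lemma occurrences_append: "occurrences t w \<subseteq> occurrences t (w @ v)"
  by (auto simp: occurrences_def)

lemma occurrences_butlast:
  assumes "i \<in> occurrences t (w @ v)" "i + length t \<le> length w"
  shows "i \<in> occurrences t w"
  using assms by (auto simp: occurrences_def)

text \<open>Every other occurrence starts at or before \<open>i\<close>, and as its interval avoids
  the position \<open>i\<close> it must end by then.\<close>

lemma disjoint_occurrences_before:
  assumes "disjoint_occurrences t (w @ v) P" "i \<in> P" "i = length w" "length v = length t" "t \<noteq> []"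
  shows "disjoint_occurrences t w (P - {i})"
proof -
  have "j \<in> occurrences t w" if j: "j \<in> P - {i}" for j
  proof (rule occurrences_butlast)
    show "j \<in> occurrences t (w @ v)" using assms(1) j by (auto simp: disjoint_occurrences_def)
    then have "j \<le> i" using assms by (auto simp: occurrences_def)
    moreover have "{j..<j + length t} \<inter> {i..<i + length t} = {}"
      using assms j by (auto simp: disjoint_occurrences_def disjoint_family_on_def)
    then have "i \<notin> {j..<j + length t}" using assms(5) by auto
    ultimately show "j + length t \<le> length w" using assms(3) by auto
  qed
  then show ?thesis using assms(1) unfolding disjoint_occurrences_def disjoint_family_on_def by auto
qed

lemma disjoint_occurrences_extend:
  assumes "disjoint_occurrences t w P" "t \<noteq> []"
  shows "disjoint_occurrences t (w @ t) (insert (length w) P)" "length w \<notin> P"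
proof -
  have P: "j + length t \<le> length w" if "j \<in> P" for j
    using assms(1) that by (auto simp: disjoint_occurrences_def occurrences_def)
  show "length w \<notin> P" using P assms(2) by fastforce
  have "insert (length w) P \<subseteq> occurrences t (w @ t)"
    using assms(1) occurrences_append[of t w t]
    by (auto simp: disjoint_occurrences_def) (simp add: occurrences_def)
  moreover have "disjoint_family_on (\<lambda>i. {i..<i + length t}) (insert (length w) P)"
    using assms(1) P unfolding disjoint_occurrences_def disjoint_family_on_def by fastforce
  ultimately show "disjoint_occurrences t (w @ t) (insert (length w) P)"
    by (simp add: disjoint_occurrences_def)
qed

context word_group
begin

text \<open>Each copy of the path with label \<open>t\<close> becomes a single letter whose weight is the cost
  \<open>length t - 1\<close> of that copy.\<close>

definition shortcut_weights :: "'a list \<Rightarrow> ('a \<times> nat) set" where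
  "shortcut_weights t = insert (val t, length t - 1) (S \<times> {1})"

lemma weighted_word_group_shortcuts:
  assumes "set t \<subseteq> S" "2 \<le> length t"
  shows "weighted_word_group G S (shortcut_weights t) (length t)"
proof unfold_locales
  fix a k assume "(a, k) \<in> shortcut_weights t"
  then show "a \<in> carrier G \<and> 1 \<le> k \<and> len a \<le> length t"
    using assms len_le[OF assms(1)] S_carrier len_gen by (fastforce simp: shortcut_weights_def)
qed (simp add: shortcut_weights_def)

text \<open>The word is consumed from the right: a final block counted in \<open>P\<close> becomes
  the shortcut letter, any other last letter stays with weight 1. Each contracted copy saves exactly
  1, which is the term \<open>card P\<close>.\<close>

lemma contract_occurrences:
  assumes t: "set t \<subseteq> S" "2 \<le> length t"
  shows "set w \<subseteq> S \<Longrightarrow> disjoint_occurrences t w P \<Longrightarrow>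
    \<exists>ws. set ws \<subseteq> shortcut_weights t \<and> sum_list (map snd ws) + card P = length w \<and>
      val (map fst ws) = val w"
proof (induction "length w" arbitrary: w P rule: less_induct)
  case less
  interpret weighted_word_group G S "shortcut_weights t" "length t" by (rule weighted_word_group_shortcuts[OF t])
  have tne: "t \<noteq> []" using t by auto
  have finP: "finite P" using less.prems finite_disjoint_occurrences by blast
  have Pocc: "i + length t \<le> length w" "take (length t) (drop i w) = t" if "i \<in> P" for i
    using less.prems that by (auto simp: disjoint_occurrences_def occurrences_def)
  show ?case
  proof (cases "\<exists>i\<in>P. i + length t = length w")
    case True
    then obtain i where i: "i \<in> P" "i + length t = length w" by blast
    define w0 where "w0 = take i w"
    have "drop i w = t" using Pocc(2)[OF i(1)] i(2) by simp
    then have w: "w = w0 @ t" "length w0 = i"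
      unfolding w0_def using i(2) append_take_drop_id[of i w] by auto
    have do: "disjoint_occurrences t w0 (P - {i})"
      by (rule disjoint_occurrences_before[of t w0 t])
        (simp_all only: w(1)[symmetric] w(2) less.prems(2) i(1) tne not_False_eq_True)
    have "length w0 < length w" "set w0 \<subseteq> S" using w less.prems tne by auto
    then obtain ws where ws: "set ws \<subseteq> shortcut_weights t" "wt ws + card (P - {i}) = length w0"
      "wval ws = val w0" using less.hyps do by blast
    have e: "set [(val t, length t - 1)] \<subseteq> shortcut_weights t" by (simp add: shortcut_weights_def)
    have "wval (ws @ [(val t, length t - 1)]) = val w0 \<otimes> val t"
      using wval_append[OF ws(1) e] ws(3) t by simp
    also have "\<dots> = val w" using w t less.prems by (simp add: val_append)
    finally have "wval (ws @ [(val t, length t - 1)]) = val w" .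
    moreover have "wt (ws @ [(val t, length t - 1)]) + card P = length w"
      using ws(2) w i t card_Suc_Diff1[OF finP i(1)] by simp
    ultimately show ?thesis using ws(1) e by (intro exI[of _ "ws @ [(val t, length t - 1)]"]) simp
  next
    case False
    show ?thesis
    proof (cases w rule: rev_cases)
      case Nil
      then have "P = {}" using Pocc tne by fastforce
      then show ?thesis using Nil by (intro exI[of _ "[]"]) auto
    next
      case (snoc w0 s)
      have "P \<subseteq> occurrences t w0"
      proof
        fix j assume j: "j \<in> P"
        have "j + length t \<le> length w0" using Pocc(1)[OF j] False j snoc by fastforce
        then show "j \<in> occurrences t w0"
          using less.prems j snoc occurrences_butlast[of j t w0 "[s]"]
          by (auto simp: disjoint_occurrences_def)
      qed
      then have "disjoint_occurrences t w0 P" using less.prems by (simp add: disjoint_occurrences_def)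
      then obtain ws where ws: "set ws \<subseteq> shortcut_weights t" "wt ws + card P = length w0" "wval ws = val w0"
        using less.hyps[of w0 P] less.prems snoc by auto
      have s: "s \<in> S" "set w0 \<subseteq> S" using less.prems snoc by auto
      then have e: "set [(s, 1)] \<subseteq> shortcut_weights t" by (simp add: shortcut_weights_def)
      have "wval (ws @ [(s, 1)]) = val w"
        using wval_append[OF ws(1) e] ws(3) snoc s by (simp add: val_append)
      then show ?thesis using ws e snoc by (intro exI[of _ "ws @ [(s, 1)]"]) simp
    qed
  qed
qed

text \<open>Converse of the contraction: writing out each shortcut as \<open>t\<close> creates an
  occurrence after all previous ones, hence disjoint from them.\<close>

lemma expand_shortcuts:
  assumes t: "set t \<subseteq> S" "2 \<le> length t"
  shows "set ws \<subseteq> shortcut_weights t \<Longrightarrow>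
    \<exists>w P. set w \<subseteq> S \<and> disjoint_occurrences t w P \<and> sum_list (map snd ws) + card P = length w \<and>
      val w = val (map fst ws)"
proof (induction ws rule: rev_induct)
  case Nil
  show ?case by (intro exI[of _ "[]"] exI[of _ "{}"]) (simp add: disjoint_occurrences_def disjoint_family_on_def)
next
  case (snoc p ws)
  interpret weighted_word_group G S "shortcut_weights t" "length t" by (rule weighted_word_group_shortcuts[OF t])
  have tne: "t \<noteq> []" using t by auto
  obtain w P where w: "set w \<subseteq> S" "disjoint_occurrences t w P" "wt ws + card P = length w" "val w = wval ws"
    using snoc by auto
  have p: "set ws \<subseteq> shortcut_weights t" "set [p] \<subseteq> shortcut_weights t" using snoc.prems by auto
  then consider "p = (val t, length t - 1)" | s where "s \<in> S" "p = (s, 1)"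
    by (auto simp: shortcut_weights_def)
  then show ?case
  proof cases
    case 1
    have "val (w @ t) = wval (ws @ [p])"
      using wval_append[OF p] w t 1 by (simp add: val_append)
    moreover have "wt (ws @ [p]) + card (insert (length w) P) = length (w @ t)"
      using w(3) t 1 finite_disjoint_occurrences[OF w(2)] disjoint_occurrences_extend(2)[OF w(2) tne] by simp
    ultimately show ?thesis using disjoint_occurrences_extend(1)[OF w(2) tne] w(1) t(1)
      by (intro exI[of _ "w @ t"] exI[of _ "insert (length w) P"]) simp
  next
    case 2
    have "val (w @ [s]) = wval (ws @ [p])"
      using wval_append[OF p] w 2 by (simp add: val_append)
    moreover have "disjoint_occurrences t (w @ [s]) P"
      using w(2) occurrences_append[of t w "[s]"] by (auto simp: disjoint_occurrences_def)
    ultimately show ?thesis using w 2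
      by (intro exI[of _ "w @ [s]"] exI[of _ P]) simp
  qed
qed

text \<open>Left translation preserves labels and acts transitively on vertices, so copies of a path
  are the paths with the same label. The translating element takes the start \<open>x\<close> to the
  vertex \<open>val u\<close> where the occurrence begins.\<close>

lemma copy_positions_path_of:
  assumes "x \<in> carrier G" "set t \<subseteq> S" "set w \<subseteq> S"
  shows "copy_positions G (path_of x t) (path_of \<one> w) = occurrences t w"
proof -
  have "(\<exists>a\<in>carrier G. take (length t) (drop i (path_of \<one> w)) = translate_path G a (path_of x t)) \<longleftrightarrow>
      take (length t) (drop i w) = t" if i: "i + length t \<le> length w" for i
  proof
    assume "\<exists>a\<in>carrier G. take (length t) (drop i (path_of \<one> w)) = translate_path G a (path_of x t)"
    then obtain a where "take (length t) (drop i (path_of \<one> w)) = translate_path G a (path_of x t)" by blast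
    then have "map snd (take (length t) (drop i (path_of \<one> w))) = map snd (translate_path G a (path_of x t))"
      by simp
    moreover have "map snd (translate_path G a (path_of x t)) = map snd (path_of x t)"
      by (simp add: translate_path_def case_prod_beta comp_def)
    ultimately show "take (length t) (drop i w) = t"
      by (simp flip: take_map drop_map)
  next
    assume e: "take (length t) (drop i w) = t"
    define u v where "u = take i w" and "v = drop (length t) (drop i w)"
    have w: "w = u @ t @ v" unfolding u_def v_def using e by (metis append_take_drop_id)
    have lu: "length u = i" using i by (simp add: u_def)
    have c: "set u \<subseteq> carrier G" "set t \<subseteq> carrier G" "val u \<in> carrier G"
      using assms S_carrier w by auto
    have "path_of \<one> w = path_of \<one> u @ path_of (val u) t @ path_of (val u \<otimes> val t) v"
      unfolding w using c by (simp add: path_of_append)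
    then have "take (length t) (drop i (path_of \<one> w)) = path_of (val u) t" using lu by simp
    moreover have "translate_path G (val u \<otimes> inv x) (path_of x t) = path_of (val u) t"
      using translate_path_of[of "val u \<otimes> inv x" x t] assms c by (simp add: m_assoc)
    ultimately show "\<exists>a\<in>carrier G. take (length t) (drop i (path_of \<one> w)) = translate_path G a (path_of x t)"
      using c assms by (intro bexI[of _ "val u \<otimes> inv x"]) auto
  qed
  then show ?thesis unfolding copy_positions_def occurrences_def by auto
qed

lemma copy_count_path_of:
  assumes "x \<in> carrier G" "set t \<subseteq> S" "set w \<subseteq> S"
  shows "\<exists>P. disjoint_occurrences t w P \<and> card P = copy_count G (path_of x t) (path_of \<one> w)"
    and "disjoint_occurrences t w P \<Longrightarrow> card P \<le> copy_count G (path_of x t) (path_of \<one> w)"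
proof -
  have cc: "copy_count G (path_of x t) (path_of \<one> w) = Max (card ` {P. disjoint_occurrences t w P})"
    using copy_positions_path_of[OF assms] by (simp add: copy_count_def disjoint_occurrences_def)
  have "{P. disjoint_occurrences t w P} \<subseteq> Pow {..length w}"
    by (auto simp: disjoint_occurrences_def occurrences_def)
  then have fin: "finite (card ` {P. disjoint_occurrences t w P})"
    by (meson finite_Pow_iff finite_atMost finite_imageI finite_subset)
  have "{} \<in> {P. disjoint_occurrences t w P}"
    by (simp add: disjoint_occurrences_def disjoint_family_on_def)
  then have "Max (card ` {P. disjoint_occurrences t w P}) \<in> card ` {P. disjoint_occurrences t w P}"
    using fin by (intro Max_in) auto
  then show "\<exists>P. disjoint_occurrences t w P \<and> card P = copy_count G (path_of x t) (path_of \<one> w)"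
    unfolding cc by auto
  show "card P \<le> copy_count G (path_of x t) (path_of \<one> w)" if "disjoint_occurrences t w P"
    unfolding cc using fin that by (intro Max_ge) auto
qed

text \<open>Contraction shows that no path costs less than the norm, and expanding a minimal
  weighted word produces a path attaining it. The supremum is thus a maximum.\<close>

lemma counting_fun_eq:
  assumes x: "x \<in> carrier G" and t: "set t \<subseteq> S" "2 \<le> length t" and a: "a \<in> carrier G"
  shows "counting_fun G S (path_of x t) a = int (len a) - int (weighted_norm G (shortcut_weights t) a)"
proof -
  interpret weighted_word_group G S "shortcut_weights t" "length t" by (rule weighted_word_group_shortcuts[OF t])
  have path: "cayley_path G S \<one> \<alpha> a \<longleftrightarrow> (\<exists>w. set w \<subseteq> S \<and> \<alpha> = path_of \<one> w \<and> a = val w)" for \<alpha>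
    unfolding cayley_path_conv[OF S_carrier] using l_one[OF val_closed] by auto
  have upper: "nrm a + copy_count G (path_of x t) (path_of \<one> w) \<le> length w"
    if w: "set w \<subseteq> S" "a = val w" for w
  proof -
    obtain P where P: "disjoint_occurrences t w P" "card P = copy_count G (path_of x t) (path_of \<one> w)"
      using copy_count_path_of(1)[OF x t(1) w(1)] by blast
    obtain ws where "set ws \<subseteq> shortcut_weights t" "wt ws + card P = length w" "wval ws = val w"
      using contract_occurrences[OF t w(1) P(1)] by blast
    then show ?thesis using norm_le[of ws] P(2) w(2) by simp
  qed
  obtain ws where ws: "set ws \<subseteq> shortcut_weights t" "wt ws = nrm a" "wval ws = a"
    using norm_word[OF a] by blast
  obtain w P where w: "set w \<subseteq> S" "disjoint_occurrences t w P" "wt ws + card P = length w" "val w = wval ws"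
    using expand_shortcuts[OF t ws(1)] by blast
  have lower: "length w \<le> nrm a + copy_count G (path_of x t) (path_of \<one> w)"
    using w ws copy_count_path_of(2)[OF x t(1) w(1,2)] by simp
  have "length w = nrm a + copy_count G (path_of x t) (path_of \<one> w)"
    using lower upper[OF w(1)] w(4) ws(3) by simp
  then have att: "path_weight G S (path_of x t) a (path_of \<one> w) = int (len a) - int (nrm a)"
    by (simp add: path_weight_def)
  show ?thesis unfolding counting_fun_def
  proof (rule cSup_eq_maximum)
    show "int (len a) - int (nrm a) \<in> {path_weight G S (path_of x t) a \<alpha> |\<alpha>. cayley_path G S \<one> \<alpha> a}"
    proof -
      have "cayley_path G S \<one> (path_of \<one> w) a"
        unfolding path using w(1,4) ws(3) by (intro exI[of _ w]) simp
      then show ?thesis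
        unfolding mem_Collect_eq att[symmetric] by (intro exI[of _ "path_of \<one> w"]) simp
    qed
  next
    fix z assume "z \<in> {path_weight G S (path_of x t) a \<alpha> |\<alpha>. cayley_path G S \<one> \<alpha> a}"
    then obtain \<alpha> where "z = path_weight G S (path_of x t) a \<alpha>" "cayley_path G S \<one> \<alpha> a" by auto
    then obtain v where v: "set v \<subseteq> S" "a = val v" "z = path_weight G S (path_of x t) a (path_of \<one> v)"
      unfolding path by auto
    then show "z \<le> int (len a) - int (nrm a)" using upper[OF v(1,2)] by (simp add: path_weight_def)
  qed
qed

end

theorem theorem3p19:
  fixes G :: "('a, 'b) monoid_scheme"
    and S :: "'a set"
    and \<sigma> :: "('a \<times> 'a) list"
    and x y :: 'a
  assumes "group G"
    and "word_hyperbolic G"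
    and "sym_generating_set G S"
    and "cayley_path G S x \<sigma> y"
    and "length \<sigma> \<ge> 2"
  shows "(\<exists>L. combing G S L) \<and>
         (\<forall>L. combing G S L \<longrightarrow> bicombable G S L (counting_quasimorphism G S \<sigma>))"
proof (intro conjI allI impI)
  interpret word_group G S by (intro word_group.intro word_group_axioms.intro assms(1,3))
  show "\<exists>L. combing G S L" by (rule hyperbolic_ex_combing[OF assms(2)])
  fix L assume L: "combing G S L"
  obtain t where t: "x \<in> carrier G" "set t \<subseteq> S" "\<sigma> = path_of x t"
    using assms(4) unfolding cayley_path_conv[OF S_carrier] by blast
  define t' where "t' = rev (map (m_inv G) t)"
  have t2: "2 \<le> length t" "2 \<le> length t'" "set t' \<subseteq> S"
    using assms(5) t(3) rev_map_inv[OF t(2)] by (simp_all add: t'_def)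
  have rev: "reverse_path G \<sigma> = path_of (x \<otimes>\<^bsub>G\<^esub> val t) t'"
    unfolding t(3) t'_def by (rule reverse_path_of[OF t(1,2)])
  have xt: "x \<otimes>\<^bsub>G\<^esub> val t \<in> carrier G" using t by auto
  \<comment> \<open>The counting functions enter with the negative of their norms, so after
    cancellation of the word lengths the norm for the reversed label \<open>t'\<close> comes
    first.\<close>
  show "bicombable G S L (counting_quasimorphism G S \<sigma>)"
  proof (rule norm_difference_bicombable[OF assms(2) L
        weighted_word_group_shortcuts[OF t2(3,2)] weighted_word_group_shortcuts[OF t(2) t2(1)]])
    fix a assume a: "a \<in> carrier G"
    show "counting_quasimorphism G S \<sigma> a =
        int (weighted_norm G (shortcut_weights t') a) - int (weighted_norm G (shortcut_weights t) a)"
      unfolding counting_quasimorphism_def rev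
      unfolding t(3) counting_fun_eq[OF t(1,2) t2(1) a] counting_fun_eq[OF xt t2(3,2) a] by simp
  qed
qed

end
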